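(* Let $\{\pi_k\}_{k\ge0}$ be the policy sequence generated by PMD with mirror map $h(p)=\sum_a\psi(p(a))$ and a constant step size $\eta>0$. Assume $\psi'(0^+)=-\infty$ and $\psi'(1^-)=+\infty$, and let $\pi_\infty=\lim_{k\to\infty}\pi_k$ be the limiting policy (which exists under these conditions). If $\psi$ is twice continuously differentiable on $\mathrm{int}\,\mathrm{dom}\,\psi$ and $0<\psi''(x)<+\infty$ for all $x\in\mathrm{int}\,\mathrm{dom}\,\psi=(0,1)$, then: (a) for any $s\in\mathcal S_{=1}$ and $\sigma\in(0,\Delta/2)$, for all $k\ge T(\sigma)$, $$\|\pi_k(\cdot|s)-\pi_\infty(\cdot|s)\|_\infty\le b_s^{\pi_k}\le|\mathcal A|\cdot\left\{\varphi^{-1}\Big(k\cdot\tfrac{\eta(\Delta-2\sigma)}{2}+\tfrac{C_1(\sigma)}{2}\Big)+\chi^{-1}\Big(k\cdot\tfrac{\eta(\Delta-2\sigma)}{2}+\tfrac{C_1(\sigma)}{2}\Big)\right\};$$ (b) for any $s\in\mathcal S_{>1}$ there are strictly positive finite constants $U_s$ and $L_s$, depending on the limiting policy $\pi_\infty(\cdot|s)$ and the second derivative $\psi''$, such that for any $\sigma\in(0,\Delta/2)$ there exists a finite iteration $T_3(\sigma)$ with $$\forall\,k\ge T_3(\sigma):\quad\|\pi_k(\cdot|s)-\pi_\infty(\cdot|s)\|_\infty\le\frac{U_s}{L_s}\,b_s^{\pi_k}+\frac{2\eta U_s}{L_s^2}\sum_{t=k}^\infty\|V^*-V^{\pi_t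}\|_\infty.$$
   Context: MDP: $(\mathcal S,\mathcal A,P,r,\gamma)$ is a finite discounted Markov decision process: finite state space $\mathcal S$, finite action space $\mathcal A$, transition model $P(\cdot|s,a)\in\Delta(\mathcal S)$, reward $r:\mathcal S\times\mathcal A\to[0,1]$, discount $\gamma\in[0,1)$. $\Delta(\mathcal X)$ is the probability simplex over a finite set $\mathcal X$. A policy $\pi$ assigns to each $s$ a distribution $\pi(\cdot|s)\in\Delta(\mathcal A)$; $\Pi$ is the set of all policies. $V^\pi(s)$ is the expected value of $\sum_{t\ge0}\gamma^t r(s_t,a_t)$ given $s_0=s$, $a_t\sim\pi(\cdot|s_t)$, $s_{t+1}\sim P(\cdot|s_t,a_t)$, and $Q^\pi(s,a)$ is the same conditioned on $(s_0,a_0)=(s,a)$. $V^*(s)=\max_{\pi\in\Pi}V^\pi(s)$, $Q^*(s,a)=\max_{\pi\in\Pi}Q^\pi(s,a)$. $\mathcal A^*_s=\{a: Q^*(s,a)=V^*(s)\}$, $\mathcal S_{=1}=\{s:|\mathcal A_s^*|=1\}$, $\mathcal S_{>1}=\{s:|\mathcal A_s^*|>1\}$, $\tilde{\mathcal S}=\{s:\mathcal A_s^*\ne\mathcal A\}$, the last assumed nonempty throughout. For $s\in\tilde{\mathcal S}$, $\Delta_s=V^*(s)-\max_{a'\notin\mathcal A_s^*}Q^*(s,a')$, and $\Delta=\min_{s\in\tilde{\mathcal S}}\Delta_s>0$ (a number; not to be confused with the simplex $\Delta(\cdot)$). $b_s^\pi=\sum_{a'\notin\mathcal A_s^*}\pi(a'|s)$.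 Mirror map: $\psi:\mathbb R\to(-\infty,+\infty]$ satisfies: (a) $\mathrm{dom}\,\psi\supseteq[0,1]$; (b) $\psi$ is proper, closed and convex; (c) $\psi$ is differentiable on $\mathrm{int}\,\mathrm{dom}\,\psi$ and $|\psi'(x_n)|\to\infty$ for every sequence $\{x_n\}\subseteq\mathrm{int}\,\mathrm{dom}\,\psi$ converging to a boundary point of $\mathrm{dom}\,\psi$; (d) $\psi$ is strictly convex on $\mathrm{int}\,\mathrm{dom}\,\psi$. $\psi'(0^+)$ and $\psi'(1^-)$ are the one-sided limits of $\psi'$ at $0$ from the right and at $1$ from the left. $h(p)=\sum_{a\in\mathcal A}\psi(p(a))$ and $D_h(p\|q)=h(p)-h(q)-\langle\nabla h(q),p-q\rangle$. PMD: given $\eta>0$ and an initial policy $\pi_0$ with $\pi_0(a|s)\in\mathrm{int}\,\mathrm{dom}\,\psi$ for all $(s,a)$ (assumed throughout), for each $s$, $\pi_{k+1}(\cdot|s)=\arg\max_{p\in\Delta(\mathcal A)}\{\eta\langle p,Q^{\pi_k}(s,\cdot)\rangle-D_h(p\|\pi_k(\cdot|s))\}$; all iterates satisfy $\pi_k(a|s)\in\mathrm{int}\,\mathrm{dom}\,\psi$. Constants: $\varphi(x):=-\psi'(x)$ and $\chi(x):=\psi'(1-x)$ are continuous strictly decreasing maps of $(0,1)$ onto $\mathbb R$, with inverses $\varphi^{-1},\chi^{-1}:\mathbb R\to(0,1)$. $T(\sigma):=\min\{k:\|V^*-V^{\pi_k}\|_\infty\le\sigma\}$ (finite). For $s\in\tilde{\mathcal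 S}$, $G_k(s):=\min_{a^*\in\mathcal A_s^*}\psi'(\pi_k(a^*|s))-\max_{a'\notin\mathcal A_s^*}\psi'(\pi_k(a'|s))$. $C_1(\sigma):=\min_{s\in\tilde{\mathcal S}}\{G_{T(\sigma)}(s)-\eta(\Delta-2\sigma)T(\sigma)\}$. *)

theory Defs
  imports "HOL-Probability.Probability"
begin

section \<open>Finite discounted Markov decision processes\<close>

text \<open>State and action spaces are types of class \<^class>\<open>finite\<close>, and the simplex over such a
  type \<open>'x\<close> is \<open>'x pmf\<close>. A policy is a function \<open>'s \<Rightarrow> 'a pmf\<close>, so the set of all policies is
  the whole type.\<close>

record ('s, 'a) mdp =
  transition :: "'s \<Rightarrow> 'a \<Rightarrow> 's pmf"
  reward :: "'s \<Rightarrow> 'a \<Rightarrow> real"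
  discount :: real

definition valid_mdp :: "('s::finite, 'a::finite) mdp \<Rightarrow> bool" where
  "valid_mdp M \<longleftrightarrow>
     (\<forall>s a. 0 \<le> reward M s a \<and> reward M s a \<le> 1) \<and> 0 \<le> discount M \<and> discount M < 1"

text \<open>Conditional law of the state-action pair at time \<open>t\<close> given the pairs at times before \<open>t\<close>,
  when the pair at time 0 has law \<open>\<mu>\<close> and the policy \<open>\<pi>\<close> is followed from time 1 on.\<close>

definition traj_kernel ::
  "('s::finite, 'a::finite) mdp \<Rightarrow> ('s \<Rightarrow> 'a pmf) \<Rightarrow> ('s \<times> 'a) pmf \<Rightarrow>
   nat \<Rightarrow> (nat \<Rightarrow> 's \<times> 'a) \<Rightarrow> ('s \<times> 'a) measure" where
  "traj_kernel M \<pi> \<mu> t \<omega> = measure_pmf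
     (case t of
        0 \<Rightarrow> \<mu>
      | Suc u \<Rightarrow> transition M (fst (\<omega> u)) (snd (\<omega> u)) \<bind> (\<lambda>s'. map_pmf (Pair s') (\<pi> s')))"

lemma Ionescu_Tulcea_traj_kernel: "Ionescu_Tulcea (traj_kernel M \<pi> \<mu>) (\<lambda>_. count_space UNIV)"
proof (rule Ionescu_Tulcea.intro)
  fix i
  show "traj_kernel M \<pi> \<mu> i \<in> PiM {0..<i} (\<lambda>_. count_space UNIV) \<rightarrow>\<^sub>M
      subprob_algebra (count_space UNIV)"
  proof (cases i)
    case 0
    then show ?thesis
      by (auto simp: traj_kernel_def[abs_def] space_subprob_algebra
          intro!: measurable_const measure_pmf.subprob_space_axioms)
  next
    case (Suc u)
    let ?K = "\<lambda>x. measure_pmf (transition M (fst x) (snd x) \<bind> (\<lambda>s'. map_pmf (Pair s') (\<pi> s')))"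
    have "?K \<in> count_space UNIV \<rightarrow>\<^sub>M subprob_algebra (count_space UNIV)"
      by (auto simp: space_subprob_algebra intro!: measure_pmf.subprob_space_axioms)
    moreover have "(\<lambda>\<omega>. \<omega> u) \<in> PiM {0..<i} (\<lambda>_. count_space UNIV) \<rightarrow>\<^sub>M count_space UNIV"
      using Suc by (intro measurable_component_singleton) auto
    ultimately have "(\<lambda>\<omega>. ?K (\<omega> u)) \<in> PiM {0..<i} (\<lambda>_. count_space UNIV) \<rightarrow>\<^sub>M
        subprob_algebra (count_space UNIV)"
      by (rule measurable_compose[rotated])
    then show ?thesis
      using Suc by (simp add: traj_kernel_def[abs_def])
  qed
next
  show "prob_space (traj_kernel M \<pi> \<mu> i \<omega>)" for i \<omega>
    by (simp add: traj_kernel_def measure_pmf.prob_space_axioms)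
qed

text \<open>The law of the infinite trajectory, obtained from these kernels by the Ionescu-Tulcea
  theorem.\<close>

definition traj ::
  "('s::finite, 'a::finite) mdp \<Rightarrow> ('s \<Rightarrow> 'a pmf) \<Rightarrow> ('s \<times> 'a) pmf \<Rightarrow>
   (nat \<Rightarrow> 's \<times> 'a) measure" where
  "traj M \<pi> \<mu> = projective_family.lim UNIV
     (Ionescu_Tulcea.CI (traj_kernel M \<pi> \<mu>) (\<lambda>_. count_space UNIV)) (\<lambda>_. count_space UNIV)"

definition expected_return ::
  "('s::finite, 'a::finite) mdp \<Rightarrow> ('s \<Rightarrow> 'a pmf) \<Rightarrow> ('s \<times> 'a) pmf \<Rightarrow> real" where
  "expected_return M \<pi> \<mu> =
     (\<integral>\<omega>. (\<Sum>t. discount M ^ t * reward M (fst (\<omega> t)) (snd (\<omega> t))) \<partial>traj M \<pi> \<mu>)"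

definition val_fun :: "('s::finite, 'a::finite) mdp \<Rightarrow> ('s \<Rightarrow> 'a pmf) \<Rightarrow> 's \<Rightarrow> real" where
  "val_fun M \<pi> s = expected_return M \<pi> (map_pmf (Pair s) (\<pi> s))"

text \<open>Conditioning on \<open>(s\<^sub>0, a\<^sub>0) = (s, a)\<close> means starting the kernels there; this also makes
  sense when \<open>\<pi>\<close> gives \<open>a\<close> probability 0 at \<open>s\<close>.\<close>

definition Q_fun :: "('s::finite, 'a::finite) mdp \<Rightarrow> ('s \<Rightarrow> 'a pmf) \<Rightarrow> 's \<Rightarrow> 'a \<Rightarrow> real" where
  "Q_fun M \<pi> s a = expected_return M \<pi> (return_pmf (s, a))"

text \<open>Both maxima over all policies are attained in a finite discounted MDP, so they are written
  as suprema.\<close>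

definition opt_val :: "('s::finite, 'a::finite) mdp \<Rightarrow> 's \<Rightarrow> real" where
  "opt_val M s = (SUP \<pi>. val_fun M \<pi> s)"

definition opt_Q :: "('s::finite, 'a::finite) mdp \<Rightarrow> 's \<Rightarrow> 'a \<Rightarrow> real" where
  "opt_Q M s a = (SUP \<pi>. Q_fun M \<pi> s a)"

definition opt_actions :: "('s::finite, 'a::finite) mdp \<Rightarrow> 's \<Rightarrow> 'a set" where
  "opt_actions M s = {a. opt_Q M s a = opt_val M s}"

text \<open>The sets \<open>S\<^sub>=\<^sub>1\<close>, \<open>S\<^sub>>\<^sub>1\<close> and \<open>S~\<close>.\<close>

definition states_eq1 :: "('s::finite, 'a::finite) mdp \<Rightarrow> 's set" where
  "states_eq1 M = {s. card (opt_actions M s) = 1}"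

definition states_gt1 :: "('s::finite, 'a::finite) mdp \<Rightarrow> 's set" where
  "states_gt1 M = {s. card (opt_actions M s) > 1}"

definition states_tilde :: "('s::finite, 'a::finite) mdp \<Rightarrow> 's set" where
  "states_tilde M = {s. opt_actions M s \<noteq> UNIV}"

definition state_gap :: "('s::finite, 'a::finite) mdp \<Rightarrow> 's \<Rightarrow> real" where
  "state_gap M s = opt_val M s - (MAX a\<in>- opt_actions M s. opt_Q M s a)"

definition gap :: "('s::finite, 'a::finite) mdp \<Rightarrow> real" where
  "gap M = (MIN s\<in>states_tilde M. state_gap M s)"

text \<open>The quantity \<open>b\<^sub>s\<^sup>\<pi>\<close>.\<close>

definition subopt_prob :: "('s::finite, 'a::finite) mdp \<Rightarrow> ('s \<Rightarrow> 'a pmf) \<Rightarrow> 's \<Rightarrow> real" where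
  "subopt_prob M \<pi> s = (\<Sum>a\<in>- opt_actions M s. pmf (\<pi> s) a)"

definition sup_norm :: "('x::finite \<Rightarrow> real) \<Rightarrow> real" where
  "sup_norm f = (MAX x. \<bar>f x\<bar>)"

definition value_error :: "('s::finite, 'a::finite) mdp \<Rightarrow> ('s \<Rightarrow> 'a pmf) \<Rightarrow> real" where
  "value_error M \<pi> = sup_norm (\<lambda>s. opt_val M s - val_fun M \<pi> s)"


section \<open>Mirror maps\<close>

definition edom :: "(real \<Rightarrow> ereal) \<Rightarrow> real set" where
  "edom \<psi> = {x. \<psi> x < \<infinity>}"

definition eepigraph :: "(real \<Rightarrow> ereal) \<Rightarrow> (real \<times> real) set" where
  "eepigraph \<psi> = {(x, y). \<psi> x \<le> ereal y}"

text \<open>The derivative of an extended-valued function; only used on the interior of its domain,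
  where \<^const>\<open>real_of_ereal\<close> loses nothing.\<close>

definition ederiv :: "(real \<Rightarrow> ereal) \<Rightarrow> real \<Rightarrow> real" where
  "ederiv \<psi> = deriv (\<lambda>x. real_of_ereal (\<psi> x))"

definition mirror_potential :: "(real \<Rightarrow> ereal) \<Rightarrow> bool" where
  "mirror_potential \<psi> \<longleftrightarrow>
     {0..1} \<subseteq> edom \<psi> \<and>
     (\<forall>x. \<psi> x \<noteq> -\<infinity>) \<and> edom \<psi> \<noteq> {} \<and>
     closed (eepigraph \<psi>) \<and>
     convex (eepigraph \<psi>) \<and>
     (\<forall>x\<in>interior (edom \<psi>). (\<lambda>x. real_of_ereal (\<psi> x)) differentiable (at x)) \<and>
     (\<forall>X x. (\<forall>n. X n \<in> interior (edom \<psi>)) \<and> X \<longlonglongrightarrow> x \<and> x \<in> frontier (edom \<psi>) \<longrightarrow>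
        filterlim (\<lambda>n. \<bar>ederiv \<psi> (X n)\<bar>) at_top sequentially) \<and>
     (\<forall>x\<in>interior (edom \<psi>). \<forall>y\<in>interior (edom \<psi>). \<forall>u. x \<noteq> y \<and> 0 < u \<and> u < 1 \<longrightarrow>
        \<psi> ((1 - u) * x + u * y) < ereal (1 - u) * \<psi> x + ereal u * \<psi> y)"

definition mirror_map :: "(real \<Rightarrow> ereal) \<Rightarrow> ('a::finite \<Rightarrow> real) \<Rightarrow> ereal" where
  "mirror_map \<psi> p = (\<Sum>a\<in>UNIV. \<psi> (p a))"

text \<open>The gradient, as the vector of partial derivatives.\<close>

definition gradient :: "(('a::finite \<Rightarrow> real) \<Rightarrow> ereal) \<Rightarrow> ('a \<Rightarrow> real) \<Rightarrow> 'a \<Rightarrow> real" where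
  "gradient h q a = deriv (\<lambda>x. real_of_ereal (h (q(a := x)))) (q a)"

definition bregman ::
  "(('a::finite \<Rightarrow> real) \<Rightarrow> ereal) \<Rightarrow> ('a \<Rightarrow> real) \<Rightarrow> ('a \<Rightarrow> real) \<Rightarrow> ereal" where
  "bregman h p q = h p - h q - ereal (\<Sum>a\<in>UNIV. gradient h q a * (p a - q a))"


section \<open>Policy mirror descent\<close>

definition pmd_sequence ::
  "('s::finite, 'a::finite) mdp \<Rightarrow> (real \<Rightarrow> ereal) \<Rightarrow> real \<Rightarrow> (nat \<Rightarrow> 's \<Rightarrow> 'a pmf) \<Rightarrow> bool" where
  "pmd_sequence M \<psi> \<eta> \<pi> \<longleftrightarrow>
     (\<forall>s a. pmf (\<pi> 0 s) a \<in> interior (edom \<psi>)) \<and>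
     (\<forall>k s. is_arg_max
        (\<lambda>p. ereal (\<eta> * (\<Sum>a\<in>UNIV. pmf p a * Q_fun M (\<pi> k) s a))
              - bregman (mirror_map \<psi>) (pmf p) (pmf (\<pi> k s)))
        (\<lambda>_. True) (\<pi> (Suc k) s))"

text \<open>\<open>T(\<sigma>)\<close>, \<open>G\<^sub>k(s)\<close>, \<open>C\<^sub>1(\<sigma>)\<close>, and the inverses of \<open>\<phi>\<close> and \<open>\<chi>\<close> on \<open>(0, 1)\<close>.\<close>

definition T_iter :: "('s::finite, 'a::finite) mdp \<Rightarrow> (nat \<Rightarrow> 's \<Rightarrow> 'a pmf) \<Rightarrow> real \<Rightarrow> nat" where
  "T_iter M \<pi> \<sigma> = (LEAST k. value_error M (\<pi> k) \<le> \<sigma>)"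

definition G_gap ::
  "('s::finite, 'a::finite) mdp \<Rightarrow> (real \<Rightarrow> ereal) \<Rightarrow> (nat \<Rightarrow> 's \<Rightarrow> 'a pmf) \<Rightarrow> nat \<Rightarrow> 's \<Rightarrow> real" where
  "G_gap M \<psi> \<pi> k s =
     (MIN a\<in>opt_actions M s. ederiv \<psi> (pmf (\<pi> k s) a)) -
     (MAX a\<in>- opt_actions M s. ederiv \<psi> (pmf (\<pi> k s) a))"

definition C1 ::
  "('s::finite, 'a::finite) mdp \<Rightarrow> (real \<Rightarrow> ereal) \<Rightarrow> real \<Rightarrow> (nat \<Rightarrow> 's \<Rightarrow> 'a pmf) \<Rightarrow> real \<Rightarrow> real" where
  "C1 M \<psi> \<eta> \<pi> \<sigma> =
     (MIN s\<in>states_tilde M.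
        G_gap M \<psi> \<pi> (T_iter M \<pi> \<sigma>) s - \<eta> * (gap M - 2 * \<sigma>) * real (T_iter M \<pi> \<sigma>))"

definition phi_inv :: "(real \<Rightarrow> ereal) \<Rightarrow> real \<Rightarrow> real" where
  "phi_inv \<psi> = inv_into {0<..<1} (\<lambda>x. - ederiv \<psi> x)"

definition chi_inv :: "(real \<Rightarrow> ereal) \<Rightarrow> real \<Rightarrow> real" where
  "chi_inv \<psi> = inv_into {0<..<1} (\<lambda>x. ederiv \<psi> (1 - x))"

end

theory Submission
  imports Defs
begin

text \<open>Convexity of the potential together with
  \<open>\<psi>' \<rightarrow> \<plusminus>\<infinity>\<close> at the ends of \<open>[0, 1]\<close> keeps every iterate in the interior of the simplex, so the
  maximization that defines a step is solved by its Lagrange condition: differences between actions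
  of the dual variables \<open>\<psi>'(\<pi>\<^sub>k(a|s))\<close> change by exactly \<open>\<eta>\<close> times the difference of the action
  values (\<open>dual_step\<close>). The same condition gives the three-point identity for the Bregman divergence
  (\<open>three_point\<close>).

  The values converge summably. The three-point identity with comparison point \<open>\<pi>\<^sub>k\<close> shows
  that the values increase, and with an optimal policy as comparison point it bounds the regret of a
  step by a telescoping term plus \<open>\<gamma>\<close> times an average of the regrets of the successor
  states. Adding up over \<open>k\<close> and taking the maximum over the states, the factor \<open>\<gamma> < 1\<close> bounds all
  partial sums of the value errors at once (\<open>summable_err\<close>). Since a policy loses at least the
  gap \<open>\<Delta>\<close> on the probability it gives to suboptimal actions, that probability tends to zero
  (\<open>b_tendsto_0\<close>).

  For the explicit rate: once the value error is below \<open>\<sigma>\<close>, each step raises the dual difference between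
  an optimal and a suboptimal action by at least \<open>\<eta>(\<Delta> - 2\<sigma>)\<close>, so it is at least a linear function
  \<open>2y\<close> of \<open>k\<close>. Then either the suboptimal dual variable is below \<open>-y\<close> or the optimal one is above
  \<open>y\<close>, which makes the suboptimal probability at most \<open>\<phi>\<inverse>(y)\<close> or \<open>\<chi>\<inverse>(y)\<close>. With a
  single optimal action the limit is the point mass there, and its distance is the suboptimal
  probability itself.

  With several optimal actions, their action values differ at time \<open>t\<close> by at most the value error,
  so their dual differences move after time \<open>k\<close> by at most \<open>\<eta>\<close> times the tail of the
  error series (\<open>optimal_dual_drift\<close>). Dual differences and total mass determine the optimal probabilities,
  and they do so in a Lipschitz way while the curvature \<open>\<psi>''\<close> is bounded below: if one probability grows
  by much, then so does its dual variable, hence all the others grow too, and the total mass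
  limits that (\<open>primal_change_le\<close>). This yields the Cauchy property and, on letting the later index tend
  to infinity, the rate.\<close>

section \<open>Finite means, the simplex and the sup norm\<close>

lemma sum_pmf_UNIV: "(\<Sum>x\<in>UNIV. pmf p x) = 1" for p :: "'x::finite pmf"
  by (rule sum_pmf_eq_1) auto

lemma weighted_mean_ge:
  fixes f :: "'x::finite \<Rightarrow> real"
  assumes "\<And>x. m \<le> f x"
  shows "m \<le> (\<Sum>x\<in>UNIV. pmf p x * f x)"
proof -
  have "m = (\<Sum>x\<in>UNIV. pmf p x * m)"
    by (simp add: sum_pmf_UNIV flip: sum_distrib_right)
  also have "\<dots> \<le> (\<Sum>x\<in>UNIV. pmf p x * f x)"
    by (intro sum_mono mult_left_mono assms) auto
  finally show ?thesis .
qed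

lemma weighted_mean_le:
  fixes f :: "'x::finite \<Rightarrow> real"
  assumes "\<And>x. f x \<le> m"
  shows "(\<Sum>x\<in>UNIV. pmf p x * f x) \<le> m"
  using weighted_mean_ge[of "- m" "\<lambda>x. - f x" p] assms by (simp add: sum_negf)

lemma mean_return_pmf: "(\<Sum>x\<in>UNIV. pmf (return_pmf y) x * f x) = (f y :: real)" for y :: "'x::finite"
proof -
  have "(\<Sum>x\<in>UNIV. pmf (return_pmf y) x * f x) = (\<Sum>x\<in>UNIV. if y = x then f x else 0)"
    by (intro sum.cong) (auto simp: indicator_def)
  then show ?thesis
    by simp
qed

lemma expectation_finite:
  fixes f :: "'x::finite \<Rightarrow> real"
  shows "measure_pmf.expectation p f = (\<Sum>x\<in>UNIV. pmf p x * f x)"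
  by (subst integral_measure_pmf[of UNIV]) auto

lemma expectation_bind_finite:
  fixes f :: "'x::finite \<Rightarrow> real" and p :: "'y::finite pmf"
  shows "measure_pmf.expectation (p \<bind> k) f = (\<Sum>y\<in>UNIV. pmf p y * measure_pmf.expectation (k y) f)"
  by (simp add: expectation_finite pmf_bind sum_distrib_left sum_distrib_right mult.assoc)
     (rule sum.swap)

lemma pmf_add_le_1:
  fixes p :: "'a::finite pmf"
  assumes "a \<noteq> b"
  shows "pmf p a + pmf p b \<le> 1"
  using assms sum_pmf_UNIV[of p] sum_mono2[of UNIV "{a, b}" "pmf p"] by simp

lemma pmf_of_simplex_point:
  fixes w :: "'a::finite \<Rightarrow> real"
  assumes "\<And>a. 0 \<le> w a" "(\<Sum>a\<in>UNIV. w a) = 1"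
  obtains p where "pmf p = w"
proof -
  have "(\<integral>\<^sup>+x. ennreal (w x) \<partial>count_space UNIV) = 1"
    by (simp add: nn_integral_count_space_finite sum_ennreal assms)
  then have "pmf (embed_pmf w) = w"
    by (intro ext pmf_embed_pmf assms) auto
  then show ?thesis ..
qed

text \<open>The hypothesis on \<open>q\<close> serves to exclude a one-point type, on which \<open>p\<close> itself would be 1.\<close>
lemma pmf_less_1:
  fixes p q :: "'a::finite pmf"
  assumes "pmf q a < 1" "\<And>b. 0 < pmf p b"
  shows "pmf p a < 1"
proof -
  obtain b where b: "b \<noteq> a"
  proof -
    have "\<exists>b. b \<noteq> a"
    proof (rule ccontr)
      assume "\<not> ?thesis"
      then have "(UNIV :: 'a set) = {a}"
        by auto
      then have "sum (pmf q) {a} = 1"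
        using sum_pmf_UNIV[of q] by (simp only:)
      then show False
        using assms(1) by simp
    qed
    then show ?thesis
      using that by blast
  qed
  then have "pmf p a + pmf p b \<le> 1"
    by (intro pmf_add_le_1) simp
  then show ?thesis
    using assms(2)[of b] by linarith
qed

lemma finite_maximizer_exists:
  fixes f :: "'x::finite \<Rightarrow> real"
  obtains x where "\<And>y. f y \<le> f x"
proof -
  have "Max (range f) \<in> range f"
    by (rule Max_in) auto
  then obtain x where x: "Max (range f) = f x"
    by blast
  have "f y \<le> f x" for y
    unfolding x[symmetric] by (rule Max_ge) auto
  then show ?thesis ..
qed

lemma abs_le_sup_norm: "\<bar>f x\<bar> \<le> sup_norm f" for f :: "'x::finite \<Rightarrow> real"
  unfolding sup_norm_def by (rule Max_ge) auto

lemma sup_norm_le: "(\<And>x. \<bar>f x\<bar> \<le> c) \<Longrightarrow> sup_norm f \<le> c" for f :: "'x::finite \<Rightarrow> real"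
  unfolding sup_norm_def by (subst Max_le_iff) auto

section \<open>State-action laws and the Bellman equations\<close>

definition move :: "('s::finite, 'a::finite) mdp \<Rightarrow> ('s \<Rightarrow> 'a pmf) \<Rightarrow> 's \<times> 'a \<Rightarrow> ('s \<times> 'a) pmf" where
  "move M \<pi> x = transition M (fst x) (snd x) \<bind> (\<lambda>s'. map_pmf (Pair s') (\<pi> s'))"

primrec law :: "('s::finite, 'a::finite) mdp \<Rightarrow> ('s \<Rightarrow> 'a pmf) \<Rightarrow> ('s \<times> 'a) pmf \<Rightarrow> nat \<Rightarrow> ('s \<times> 'a) pmf" where
  "law M \<pi> \<mu> 0 = \<mu>"
| "law M \<pi> \<mu> (Suc t) = law M \<pi> \<mu> t \<bind> move M \<pi>"

lemma law_bind: "law M \<pi> (p \<bind> f) t = p \<bind> (\<lambda>y. law M \<pi> (f y) t)"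
  by (induction t) (simp_all add: bind_assoc_pmf)

lemma law_Suc_shift: "law M \<pi> \<mu> (Suc t) = law M \<pi> (\<mu> \<bind> move M \<pi>) t"
  by (induction t) simp_all

text \<open>The product measure is the projective limit of the prefix measures of the Ionescu-Tulcea
  construction, so an integrand that reads coordinate \<open>t\<close> only needs the prefix of length \<open>Suc t\<close>.\<close>
lemma nn_integral_traj:
  fixes f :: "('s::finite \<times> 'a::finite) \<Rightarrow> ennreal"
  shows "(\<integral>\<^sup>+\<omega>. f (\<omega> t) \<partial>traj M \<pi> \<mu>) = (\<integral>\<^sup>+x. f x \<partial>law M \<pi> \<mu> t)"
proof -
  let ?N = "\<lambda>_::nat. count_space (UNIV :: ('s \<times> 'a) set)"
  interpret IT: Ionescu_Tulcea "traj_kernel M \<pi> \<mu>" ?N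
    by (rule Ionescu_Tulcea_traj_kernel)
  have meas: "(\<lambda>\<omega>. f (\<omega> i)) \<in> borel_measurable (PiM J ?N)" if "i \<in> J" for i J f
    using measurable_component_singleton[OF that, of ?N] by (rule measurable_compose) simp
  have kernel_0: "traj_kernel M \<pi> \<mu> 0 \<omega> = measure_pmf \<mu>" for \<omega>
    by (simp add: traj_kernel_def)
  have kernel_Suc: "traj_kernel M \<pi> \<mu> (Suc u) \<omega> = measure_pmf (move M \<pi> (\<omega> u))" for u \<omega>
    by (simp add: traj_kernel_def move_def)
  \<comment> \<open>The last coordinate of a prefix is drawn by a kernel that looks at the previous coordinate alone.\<close>
  have prefix: "(\<integral>\<^sup>+\<omega>. f (\<omega> n) \<partial>IT.C 0 (Suc n) (\<lambda>_. undefined)) = (\<integral>\<^sup>+x. f x \<partial>law M \<pi> \<mu> n)"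
    for n and f :: "('s \<times> 'a) \<Rightarrow> ennreal"
  proof (induction n arbitrary: f)
    case 0
    have und: "(\<lambda>_. undefined) \<in> space (PiM {0..<0} ?N)"
      by (simp add: space_PiM)
    have "IT.C 0 (Suc 0) (\<lambda>_. undefined) = IT.eP 0 (\<lambda>_. undefined)"
      using bind_return[OF IT.measurable_eP und] by simp
    then show ?case
      using IT.nn_integral_eP[OF und meas, of 0 f] by (simp only: kernel_0 fun_upd_same law.simps) simp
  next
    case (Suc n)
    let ?C = "IT.C 0 (Suc n) (\<lambda>_. undefined)"
    have und: "(\<lambda>_. undefined) \<in> space (PiM {0..<0} ?N)"
      by (simp add: space_PiM)
    have sets_C: "sets ?C = sets (PiM {0..<Suc n} ?N)" and space_C: "space ?C = space (PiM {0..<Suc n} ?N)"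
      using IT.sets_C[OF und, of "Suc n"] IT.space_C[OF und, of "Suc n"] by auto
    have eP: "IT.eP (Suc n) \<in> measurable ?C (subprob_algebra (PiM {0..<Suc (Suc n)} ?N))"
      unfolding measurable_cong_sets[OF sets_C refl] by (rule IT.measurable_eP)
    have "(\<integral>\<^sup>+\<omega>. f (\<omega> (Suc n)) \<partial>IT.C 0 (Suc (Suc n)) (\<lambda>_. undefined))
        = (\<integral>\<^sup>+\<omega>. \<integral>\<^sup>+\<omega>'. f (\<omega>' (Suc n)) \<partial>IT.eP (Suc n) \<omega> \<partial>?C)"
      using nn_integral_bind[OF meas eP, of "Suc n" f] by simp
    also have "\<dots> = (\<integral>\<^sup>+\<omega>. \<integral>\<^sup>+x. f x \<partial>move M \<pi> (\<omega> n) \<partial>?C)"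
    proof (rule nn_integral_cong)
      fix \<omega> assume "\<omega> \<in> space ?C"
      then have "\<omega> \<in> space (PiM {0..<Suc n} ?N)"
        using space_C by simp
      from IT.nn_integral_eP[OF this meas, of "Suc n" f]
      show "(\<integral>\<^sup>+\<omega>'. f (\<omega>' (Suc n)) \<partial>IT.eP (Suc n) \<omega>) = (\<integral>\<^sup>+x. f x \<partial>move M \<pi> (\<omega> n))"
        by (simp add: kernel_Suc)
    qed
    also have "\<dots> = (\<integral>\<^sup>+y. \<integral>\<^sup>+x. f x \<partial>move M \<pi> y \<partial>law M \<pi> \<mu> n)"
      by (rule Suc.IH)
    also have "\<dots> = (\<integral>\<^sup>+x. f x \<partial>law M \<pi> \<mu> (Suc n))"
      by (simp add: nn_integral_bind_pmf)
    finally show ?case .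
  qed
  let ?J = "{0..<Suc t}"
  have up_to: "IT.up_to ?J = Suc t"
    using IT.up_to_iff[of ?J "Suc t"] IT.up_to_less[of ?J t] by auto
  have restr: "(\<lambda>\<omega>. restrict \<omega> ?J) \<in> measurable L (PiM ?J ?N)" if "sets L = sets (PiM K ?N)" "?J \<subseteq> K" for L K
    using measurable_restrict_subset[OF that(2), of ?N] by (simp add: measurable_cong_sets[OF that(1) refl])
  have und: "(\<lambda>_. undefined) \<in> space (PiM {0..<0} ?N)"
    by (simp add: space_PiM)
  have "(\<integral>\<^sup>+\<omega>. f (\<omega> t) \<partial>traj M \<pi> \<mu>) = (\<integral>\<^sup>+\<omega>. f (\<omega> t) \<partial>distr IT.PF.lim (PiM ?J ?N) (\<lambda>\<omega>. restrict \<omega> ?J))"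
    using nn_integral_distr[OF restr[OF IT.PF.sets_lim subset_UNIV], of "\<lambda>\<omega>. f (\<omega> t)"] meas[of t ?J f] by (simp add: traj_def)
  also have "\<dots> = (\<integral>\<^sup>+\<omega>. f (\<omega> t) \<partial>distr (IT.C 0 (Suc t) (\<lambda>_. undefined)) (PiM ?J ?N) (\<lambda>\<omega>. restrict \<omega> ?J))"
    by (simp only: IT.distr_lim[OF finite_atLeastLessThan] IT.CI_def up_to)
  also have "\<dots> = (\<integral>\<^sup>+\<omega>. f (\<omega> t) \<partial>IT.C 0 (Suc t) (\<lambda>_. undefined))"
  proof -
    have "sets (IT.C 0 (Suc t) (\<lambda>_. undefined)) = sets (PiM ?J ?N)"
      using IT.sets_C[OF und, of "Suc t"] by (simp only: add_0)
    from nn_integral_distr[OF restr[OF this order_refl], of "\<lambda>\<omega>. f (\<omega> t)"] meas[of t ?J f] show ?thesis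
      by simp
  qed
  also have "\<dots> = (\<integral>\<^sup>+x. f x \<partial>law M \<pi> \<mu> t)"
    by (rule prefix)
  finally show ?thesis .
qed

lemma sets_traj: "sets (traj M \<pi> \<mu>) = sets (PiM UNIV (\<lambda>_. count_space UNIV))"
proof -
  interpret IT: Ionescu_Tulcea "traj_kernel M \<pi> \<mu>" "\<lambda>_. count_space UNIV"
    by (rule Ionescu_Tulcea_traj_kernel)
  show ?thesis
    by (simp add: traj_def)
qed

lemma distr_traj: "distr (traj M \<pi> \<mu>) (count_space UNIV) (\<lambda>\<omega>. \<omega> t) = measure_pmf (law M \<pi> \<mu> t)"
proof -
  have m: "(\<lambda>\<omega>. \<omega> t) \<in> measurable (traj M \<pi> \<mu>) (count_space UNIV)"
    using measurable_component_singleton[of t UNIV "\<lambda>_. count_space UNIV"]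
    by (simp add: measurable_cong_sets[OF sets_traj refl])
  show ?thesis
  proof (rule measure_eqI)
    fix A :: "('a \<times> 'b) set"
    have "emeasure (distr (traj M \<pi> \<mu>) (count_space UNIV) (\<lambda>\<omega>. \<omega> t)) A
       = (\<integral>\<^sup>+\<omega>. indicator A (\<omega> t) \<partial>traj M \<pi> \<mu>)"
      using nn_integral_distr[OF m, of "indicator A"] by simp
    then show "emeasure (distr (traj M \<pi> \<mu>) (count_space UNIV) (\<lambda>\<omega>. \<omega> t)) A = emeasure (law M \<pi> \<mu> t) A"
      by (simp add: nn_integral_traj)
  qed simp
qed

text \<open>Rewards are bounded by 1, so the geometric series dominates and sum and integral may be
  interchanged.\<close>
lemma expected_return_eq_suminf:
  fixes M :: "('s::finite, 'a::finite) mdp"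
  assumes "valid_mdp M"
  shows "summable (\<lambda>t. discount M ^ t * measure_pmf.expectation (law M \<pi> \<mu> t) (\<lambda>x. reward M (fst x) (snd x)))"
    and "expected_return M \<pi> \<mu> =
     (\<Sum>t. discount M ^ t * measure_pmf.expectation (law M \<pi> \<mu> t) (\<lambda>x. reward M (fst x) (snd x)))"
proof -
  let ?r = "\<lambda>x. reward M (fst x) (snd x)"
  let ?f = "\<lambda>t \<omega>. discount M ^ t * reward M (fst (\<omega> t)) (snd (\<omega> t))"
  have \<gamma>: "0 \<le> discount M" "discount M < 1" and r: "0 \<le> reward M s a" "reward M s a \<le> 1" for s a
    using assms by (auto simp: valid_mdp_def)
  interpret prob_space "traj M \<pi> \<mu>"
  proof (rule prob_spaceI)
    show "emeasure (traj M \<pi> \<mu>) (space (traj M \<pi> \<mu>)) = 1"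
      using nn_integral_traj[where f="\<lambda>_. 1" and M=M and \<pi>=\<pi> and \<mu>=\<mu>] by simp
  qed
  have m: "(\<lambda>\<omega>. \<omega> t) \<in> measurable (traj M \<pi> \<mu>) (count_space UNIV)" for t
    using measurable_component_singleton[of t UNIV "\<lambda>_. count_space UNIV"]
    by (simp add: measurable_cong_sets[OF sets_traj refl])
  have mf: "?f t \<in> borel_measurable (traj M \<pi> \<mu>)" for t
    using measurable_compose[OF m[of t], of "\<lambda>x. discount M ^ t * ?r x" borel] by simp
  have bd: "norm (?f t \<omega>) \<le> discount M ^ t" for t \<omega>
    using \<gamma> r mult_left_mono[of "?r (\<omega> t)" 1 "discount M ^ t"] by (simp add: abs_mult)
  have int: "integrable (traj M \<pi> \<mu>) (?f t)" for t
    using bd by (intro integrable_const_bound[where B="discount M ^ t"] mf) auto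
  have geo: "summable (\<lambda>t. discount M ^ t)"
    using \<gamma> by (simp add: summable_geometric)
  have eq: "(\<integral>\<omega>. ?f t \<omega> \<partial>traj M \<pi> \<mu>) = discount M ^ t * measure_pmf.expectation (law M \<pi> \<mu> t) ?r" for t
    using integral_distr[OF m[of t], of "\<lambda>x. discount M ^ t * ?r x"] by (auto simp: distr_traj)
  have norm_int: "(\<integral>\<omega>. norm (?f t \<omega>) \<partial>traj M \<pi> \<mu>) \<le> discount M ^ t" for t
    using integral_mono[of "traj M \<pi> \<mu>" "\<lambda>\<omega>. norm (?f t \<omega>)" "\<lambda>_. discount M ^ t"] int[of t] bd
    by (simp add: prob_space)
  have sums: "(\<lambda>t. \<integral>\<omega>. ?f t \<omega> \<partial>traj M \<pi> \<mu>) sums (\<integral>\<omega>. (\<Sum>t. ?f t \<omega>) \<partial>traj M \<pi> \<mu>)"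
  proof (rule sums_integral)
    show "AE \<omega> in traj M \<pi> \<mu>. summable (\<lambda>t. norm (?f t \<omega>))"
      using bd by (intro AE_I2 summable_comparison_test'[OF geo]) auto
    show "summable (\<lambda>t. \<integral>\<omega>. norm (?f t \<omega>) \<partial>traj M \<pi> \<mu>)"
      using norm_int by (intro summable_comparison_test'[OF geo]) auto
  qed (rule int)
  show "summable (\<lambda>t. discount M ^ t * measure_pmf.expectation (law M \<pi> \<mu> t) ?r)"
    using sums unfolding eq by (rule sums_summable)
  show "expected_return M \<pi> \<mu> = (\<Sum>t. discount M ^ t * measure_pmf.expectation (law M \<pi> \<mu> t) ?r)"
    using sums unfolding eq expected_return_def by (rule sums_unique)
qed

text \<open>The return is affine in the initial law. Both Bellman equations are instances: disintegrate the
  initial law over the first action, or over the successor state.\<close>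
lemma expected_return_bind:
  fixes M :: "('s::finite, 'a::finite) mdp" and p :: "'y::finite pmf"
  assumes "valid_mdp M"
  shows "expected_return M \<pi> (p \<bind> k) = (\<Sum>y\<in>UNIV. pmf p y * expected_return M \<pi> (k y))"
proof -
  let ?e = "\<lambda>\<mu> t. measure_pmf.expectation (law M \<pi> \<mu> t) (\<lambda>x. reward M (fst x) (snd x))"
  note summable = expected_return_eq_suminf(1)[OF assms] and ret = expected_return_eq_suminf(2)[OF assms]
  have "expected_return M \<pi> (p \<bind> k) = (\<Sum>t. \<Sum>y\<in>UNIV. pmf p y * (discount M ^ t * ?e (k y) t))"
    by (simp add: ret law_bind expectation_bind_finite sum_distrib_left mult.left_commute)
  also have "\<dots> = (\<Sum>y\<in>UNIV. \<Sum>t. pmf p y * (discount M ^ t * ?e (k y) t))"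
    by (intro suminf_sum summable_mult summable)
  also have "\<dots> = (\<Sum>y\<in>UNIV. pmf p y * expected_return M \<pi> (k y))"
    by (simp add: ret suminf_mult[OF summable])
  finally show ?thesis .
qed

lemma val_fun_eq:
  assumes "valid_mdp M"
  shows "val_fun M \<pi> s = (\<Sum>a\<in>UNIV. pmf (\<pi> s) a * Q_fun M \<pi> s a)"
  unfolding val_fun_def Q_fun_def map_pmf_def expected_return_bind[OF assms] ..

lemma Q_fun_eq:
  assumes "valid_mdp M"
  shows "Q_fun M \<pi> s a = reward M s a + discount M * (\<Sum>s'\<in>UNIV. pmf (transition M s a) s' * val_fun M \<pi> s')"
proof -
  let ?e = "\<lambda>\<mu> t. measure_pmf.expectation (law M \<pi> \<mu> t) (\<lambda>x. reward M (fst x) (snd x))"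
  note summable = expected_return_eq_suminf(1)[OF assms] and ret = expected_return_eq_suminf(2)[OF assms]
  have move: "move M \<pi> (s, a) = transition M s a \<bind> (\<lambda>s'. map_pmf (Pair s') (\<pi> s'))"
    by (simp add: move_def)
  have "Q_fun M \<pi> s a = (\<Sum>t. discount M ^ Suc t * ?e (return_pmf (s, a)) (Suc t)) + ?e (return_pmf (s, a)) 0"
    unfolding Q_fun_def ret using suminf_split_head[OF summable[of \<pi> "return_pmf (s, a)"]] by (simp del: law.simps(2))
  also have "\<dots> = discount M * expected_return M \<pi> (move M \<pi> (s, a)) + reward M s a"
    unfolding law_Suc_shift ret
    by (simp add: bind_return_pmf mult.assoc suminf_mult[OF summable])
  also have "expected_return M \<pi> (move M \<pi> (s, a)) = (\<Sum>s'\<in>UNIV. pmf (transition M s a) s' * val_fun M \<pi> s')"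
    unfolding move expected_return_bind[OF assms] val_fun_def ..
  finally show ?thesis by simp
qed

section \<open>Optimal policies\<close>

definition next_value :: "('s::finite, 'a::finite) mdp \<Rightarrow> ('s \<Rightarrow> real) \<Rightarrow> 's \<Rightarrow> 'a \<Rightarrow> real" where
  "next_value M u s a = (\<Sum>s'\<in>UNIV. pmf (transition M s a) s' * u s')"

lemma next_value_diff: "next_value M (\<lambda>s. u s - v s) s a = next_value M u s a - next_value M v s a"
  by (simp add: next_value_def right_diff_distrib sum_subtractf)

text \<open>A minimum principle: at a state where \<open>u\<close> is least, the average over successors is at least
  \<open>u\<close>, so the inequality reads \<open>\<gamma> u \<le> u\<close> there. All comparisons between values of policies reduce to
  it.\<close>
lemma discounted_supersolution_nonneg:
  fixes u :: "'s::finite \<Rightarrow> real"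
  assumes \<gamma>: "0 \<le> \<gamma>" "\<gamma> < 1"
    and super: "\<And>s. \<gamma> * (\<Sum>a\<in>UNIV. pmf (\<pi> s) a * next_value M u s a) \<le> u s"
  shows "0 \<le> u s"
proof -
  obtain s0 where s0: "\<And>s. - u s \<le> - u s0"
    using finite_maximizer_exists[of "\<lambda>s. - u s"] by blast
  then have s0: "u s0 \<le> u s" for s
    by simp
  have "u s0 \<le> (\<Sum>a\<in>UNIV. pmf (\<pi> s0) a * next_value M u s0 a)"
    unfolding next_value_def by (intro weighted_mean_ge s0)
  then have "\<gamma> * u s0 \<le> u s0"
    by (rule order_trans[OF mult_left_mono[OF _ \<gamma>(1)] super])
  then have "0 \<le> (1 - \<gamma>) * u s0"
    by (simp add: algebra_simps)
  then have "0 \<le> u s0"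
    using \<gamma>(2) by (simp add: zero_le_mult_iff)
  then show ?thesis
    using s0[of s] by linarith
qed

context
  fixes M :: "('s::finite, 'a::finite) mdp"
  assumes valid: "valid_mdp M"
begin

lemma discount_bounds: "0 \<le> discount M" "discount M < 1"
  using valid by (auto simp: valid_mdp_def)

lemma Q_fun_eq_next: "Q_fun M \<pi> s a = reward M s a + discount M * next_value M (val_fun M \<pi>) s a"
  by (simp add: Q_fun_eq[OF valid] next_value_def)

lemma Q_fun_diff:
  "Q_fun M \<pi>' s a - Q_fun M \<pi> s a = discount M * next_value M (\<lambda>s. val_fun M \<pi>' s - val_fun M \<pi> s) s a"
  by (simp add: Q_fun_eq_next next_value_diff right_diff_distrib)

text \<open>One step of the performance difference identity; the discounted remainder is left in recursive
  form, which suits the minimum principle and avoids visitation measures.\<close>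
lemma val_fun_diff:
  "val_fun M \<pi>' s - val_fun M \<pi> s = (\<Sum>a\<in>UNIV. (pmf (\<pi>' s) a - pmf (\<pi> s) a) * Q_fun M \<pi> s a)
    + discount M * (\<Sum>a\<in>UNIV. pmf (\<pi>' s) a * next_value M (\<lambda>s. val_fun M \<pi>' s - val_fun M \<pi> s) s a)"
proof -
  have "discount M * (\<Sum>a\<in>UNIV. pmf (\<pi>' s) a * next_value M (\<lambda>s. val_fun M \<pi>' s - val_fun M \<pi> s) s a)
     = (\<Sum>a\<in>UNIV. pmf (\<pi>' s) a * (Q_fun M \<pi>' s a - Q_fun M \<pi> s a))"
    by (simp add: Q_fun_diff sum_distrib_left mult.left_commute)
  then show ?thesis
    by (simp add: val_fun_eq[OF valid] algebra_simps sum.distrib sum_subtractf)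
qed

lemma policy_improvement:
  assumes "\<And>s. 0 \<le> (\<Sum>a\<in>UNIV. (pmf (\<pi>' s) a - pmf (\<pi> s) a) * Q_fun M \<pi> s a)"
  shows "val_fun M \<pi> s \<le> val_fun M \<pi>' s"
    and "(\<Sum>a\<in>UNIV. (pmf (\<pi>' s) a - pmf (\<pi> s) a) * Q_fun M \<pi> s a) \<le> val_fun M \<pi>' s - val_fun M \<pi> s"
proof -
  have mono: "0 \<le> val_fun M \<pi>' s - val_fun M \<pi> s" for s
  proof (rule discounted_supersolution_nonneg[where \<gamma> = "discount M" and \<pi> = \<pi>' and M = M])
    show "discount M * (\<Sum>a\<in>UNIV. pmf (\<pi>' s) a * next_value M (\<lambda>s. val_fun M \<pi>' s - val_fun M \<pi> s) s a)
      \<le> val_fun M \<pi>' s - val_fun M \<pi> s" for s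
      using val_fun_diff[of \<pi>' s \<pi>] assms[of s] by linarith
  qed (rule discount_bounds)+
  then show "val_fun M \<pi> s \<le> val_fun M \<pi>' s"
    by simp
  have "0 \<le> (\<Sum>a\<in>UNIV. pmf (\<pi>' s) a * next_value M (\<lambda>s. val_fun M \<pi>' s - val_fun M \<pi> s) s a)"
    unfolding next_value_def by (intro weighted_mean_ge mono)
  then have "0 \<le> discount M * (\<Sum>a\<in>UNIV. pmf (\<pi>' s) a * next_value M (\<lambda>s. val_fun M \<pi>' s - val_fun M \<pi> s) s a)"
    using discount_bounds by simp
  then show "(\<Sum>a\<in>UNIV. (pmf (\<pi>' s) a - pmf (\<pi> s) a) * Q_fun M \<pi> s a) \<le> val_fun M \<pi>' s - val_fun M \<pi> s"
    using val_fun_diff[of \<pi>' s \<pi>] by linarith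
qed

lemma unimprovable_policy_dominates:
  assumes "\<And>s a. Q_fun M \<pi> s a \<le> val_fun M \<pi> s"
  shows "val_fun M \<pi>' s \<le> val_fun M \<pi> s"
proof -
  have "0 \<le> val_fun M \<pi> s - val_fun M \<pi>' s" for s
  proof (rule discounted_supersolution_nonneg[where \<gamma> = "discount M" and \<pi> = \<pi>' and M = M])
    fix s
    have "(\<Sum>a\<in>UNIV. pmf (\<pi>' s) a * Q_fun M \<pi> s a) \<le> val_fun M \<pi> s"
      by (rule weighted_mean_le) (rule assms)
    moreover have "discount M * (\<Sum>a\<in>UNIV. pmf (\<pi>' s) a * next_value M (\<lambda>s. val_fun M \<pi> s - val_fun M \<pi>' s) s a)
      = (\<Sum>a\<in>UNIV. pmf (\<pi>' s) a * (Q_fun M \<pi> s a - Q_fun M \<pi>' s a))"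
      by (simp add: Q_fun_diff sum_distrib_left mult.left_commute)
    moreover have "\<dots> = (\<Sum>a\<in>UNIV. pmf (\<pi>' s) a * Q_fun M \<pi> s a) - val_fun M \<pi>' s"
      unfolding val_fun_eq[OF valid, of \<pi>'] right_diff_distrib sum_subtractf ..
    ultimately show "discount M * (\<Sum>a\<in>UNIV. pmf (\<pi>' s) a * next_value M (\<lambda>s. val_fun M \<pi> s - val_fun M \<pi>' s) s a)
      \<le> val_fun M \<pi> s - val_fun M \<pi>' s"
      by linarith
  qed (rule discount_bounds)+
  then show ?thesis by simp
qed

text \<open>There are finitely many deterministic policies. One that maximizes the total value over all
  states cannot be improved by acting greedily, since greedy improvement raises no state less than its
  advantage and lowers none.\<close>
lemma unimprovable_policy_exists:
  obtains \<pi> where "\<And>s a. Q_fun M \<pi> s a \<le> val_fun M \<pi> s"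
proof -
  define total where "total d = (\<Sum>s\<in>UNIV. val_fun M (\<lambda>s. return_pmf (d s)) s)" for d :: "'s \<Rightarrow> 'a"
  obtain d where d: "\<And>d'. total d' \<le> total d"
    using finite_maximizer_exists[of total] by blast
  let ?\<pi> = "\<lambda>s. return_pmf (d s)"
  have "\<exists>a. \<forall>b. Q_fun M ?\<pi> s b \<le> Q_fun M ?\<pi> s a" for s
    using finite_maximizer_exists[of "Q_fun M ?\<pi> s"] by blast
  then obtain d' where d': "\<And>s b. Q_fun M ?\<pi> s b \<le> Q_fun M ?\<pi> s (d' s)"
    by metis
  let ?\<pi>' = "\<lambda>s. return_pmf (d' s)"
  have val: "val_fun M ?\<pi> s = Q_fun M ?\<pi> s (d s)" for s
    by (simp add: val_fun_eq[OF valid] mean_return_pmf)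
  have gain: "(\<Sum>a\<in>UNIV. (pmf (?\<pi>' s) a - pmf (?\<pi> s) a) * Q_fun M ?\<pi> s a)
      = Q_fun M ?\<pi> s (d' s) - val_fun M ?\<pi> s" for s
    by (simp only: val left_diff_distrib sum_subtractf mean_return_pmf)
  have nonneg: "0 \<le> Q_fun M ?\<pi> s (d' s) - val_fun M ?\<pi> s" for s
    using d'[of s "d s"] val by simp
  have gap: "Q_fun M ?\<pi> s (d' s) - val_fun M ?\<pi> s \<le> val_fun M ?\<pi>' s - val_fun M ?\<pi> s" for s
    using policy_improvement(2)[of ?\<pi>' ?\<pi> s] nonneg unfolding gain by blast
  have "Q_fun M ?\<pi> s (d' s) \<le> val_fun M ?\<pi> s" for s
  proof -
    have "Q_fun M ?\<pi> s (d' s) - val_fun M ?\<pi> s \<le> (\<Sum>s\<in>UNIV. Q_fun M ?\<pi> s (d' s) - val_fun M ?\<pi> s)"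
      by (rule member_le_sum) (use nonneg in auto)
    also have "\<dots> \<le> total d' - total d"
      unfolding total_def sum_subtractf[symmetric] by (intro sum_mono gap)
    also have "\<dots> \<le> 0"
      using d[of d'] by simp
    finally show ?thesis by simp
  qed
  then show ?thesis
    using that[of ?\<pi>] d' order_trans by blast
qed

text \<open>An unimprovable policy dominates every policy in every state simultaneously, so it attains all
  the suprema that define the optimal values.\<close>
lemma optimal_policy_exists:
  obtains \<pi> where "val_fun M \<pi> = opt_val M" "Q_fun M \<pi> = opt_Q M" "\<And>s a. opt_Q M s a \<le> opt_val M s"
proof -
  obtain \<pi> where \<pi>: "\<And>s a. Q_fun M \<pi> s a \<le> val_fun M \<pi> s"
    using unimprovable_policy_exists by blast
  have dom: "val_fun M \<pi>' s \<le> val_fun M \<pi> s" for \<pi>' s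
    by (rule unimprovable_policy_dominates[OF \<pi>])
  have Qdom: "Q_fun M \<pi>' s a \<le> Q_fun M \<pi> s a" for \<pi>' s a
  proof -
    have "0 \<le> next_value M (\<lambda>s. val_fun M \<pi> s - val_fun M \<pi>' s) s a"
      unfolding next_value_def by (intro weighted_mean_ge) (simp add: dom)
    then show ?thesis
      using Q_fun_diff[of \<pi> s a \<pi>'] discount_bounds by (metis diff_ge_0_iff_ge mult_nonneg_nonneg)
  qed
  have V: "val_fun M \<pi> = opt_val M"
    unfolding opt_val_def by (rule ext, rule cSup_eq_maximum[symmetric]) (auto intro: dom)
  have Q: "Q_fun M \<pi> = opt_Q M"
    unfolding opt_Q_def by (rule ext, rule ext, rule cSup_eq_maximum[symmetric]) (auto intro: Qdom)
  show ?thesis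
    using that[of \<pi>] \<pi> V Q by simp
qed

lemma val_fun_le_opt: "val_fun M \<pi> s \<le> opt_val M s"
  using unimprovable_policy_dominates[of _ \<pi> s] optimal_policy_exists by metis

lemma opt_Q_le_opt_val: "opt_Q M s a \<le> opt_val M s"
  using optimal_policy_exists by metis

lemma opt_Q_minus_Q_fun:
  "opt_Q M s a - Q_fun M \<pi> s a = discount M * next_value M (\<lambda>s. opt_val M s - val_fun M \<pi> s) s a"
  using Q_fun_diff[of _ s a \<pi>] optimal_policy_exists by metis

lemma opt_val_minus_val_fun_le: "opt_val M s - val_fun M \<pi> s \<le> value_error M \<pi>"
  unfolding value_error_def by (rule order_trans[OF abs_ge_self abs_le_sup_norm])

lemma value_error_nonneg: "0 \<le> value_error M \<pi>"
  unfolding value_error_def by (rule order_trans[OF abs_ge_zero abs_le_sup_norm])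

lemma Q_fun_le_opt: "Q_fun M \<pi> s a \<le> opt_Q M s a"
proof -
  have "0 \<le> next_value M (\<lambda>s. opt_val M s - val_fun M \<pi> s) s a"
    unfolding next_value_def by (intro weighted_mean_ge) (simp add: val_fun_le_opt)
  then show ?thesis
    using opt_Q_minus_Q_fun[of s a \<pi>] discount_bounds by (metis diff_ge_0_iff_ge mult_nonneg_nonneg)
qed

lemma opt_Q_minus_Q_fun_le: "opt_Q M s a - Q_fun M \<pi> s a \<le> value_error M \<pi>"
proof -
  have "next_value M (\<lambda>s. opt_val M s - val_fun M \<pi> s) s a \<le> value_error M \<pi>"
    unfolding next_value_def by (intro weighted_mean_le opt_val_minus_val_fun_le)
  then have "discount M * next_value M (\<lambda>s. opt_val M s - val_fun M \<pi> s) s a \<le> discount M * value_error M \<pi>"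
    by (rule mult_left_mono) (rule discount_bounds)
  also have "\<dots> \<le> 1 * value_error M \<pi>"
    using discount_bounds value_error_nonneg by (intro mult_right_mono) auto
  finally show ?thesis
    by (simp add: opt_Q_minus_Q_fun)
qed

lemma opt_actions_nonempty: "opt_actions M s \<noteq> {}"
proof -
  obtain \<pi> where V: "val_fun M \<pi> = opt_val M" and Q: "Q_fun M \<pi> = opt_Q M"
    by (rule optimal_policy_exists)
  obtain a where a: "\<And>b. opt_Q M s b \<le> opt_Q M s a"
    using finite_maximizer_exists[of "opt_Q M s"] by blast
  have "opt_val M s = (\<Sum>a\<in>UNIV. pmf (\<pi> s) a * opt_Q M s a)"
    using val_fun_eq[OF valid, of \<pi> s] V Q by simp
  also have "\<dots> \<le> opt_Q M s a"
    by (rule weighted_mean_le) (rule a)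
  finally have "a \<in> opt_actions M s"
    using opt_Q_le_opt_val[of s a] by (simp add: opt_actions_def)
  then show ?thesis
    by blast
qed

lemma gap_le:
  assumes "a \<notin> opt_actions M s"
  shows "gap M \<le> opt_val M s - opt_Q M s a"
proof -
  have "gap M \<le> state_gap M s"
    unfolding gap_def
  proof (rule Min_le)
    have "s \<in> states_tilde M"
      using assms by (auto simp: states_tilde_def)
    then show "state_gap M s \<in> state_gap M ` states_tilde M"
      by (rule imageI)
  qed simp
  also have "state_gap M s \<le> opt_val M s - opt_Q M s a"
    unfolding state_gap_def using assms by (intro diff_left_mono Max_ge) auto
  finally show ?thesis .
qed

lemma gap_pos:
  assumes "states_tilde M \<noteq> {}"
  shows "0 < gap M"
proof -
  have "0 < state_gap M s" if s: "s \<in> states_tilde M" for s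
  proof -
    have "- opt_actions M s \<noteq> {}"
      using s by (auto simp: states_tilde_def)
    moreover have "opt_Q M s a < opt_val M s" if "a \<notin> opt_actions M s" for a
      using that opt_Q_le_opt_val[of s a] by (force simp: opt_actions_def)
    ultimately show ?thesis
      unfolding state_gap_def by (subst diff_gt_0_iff_gt, subst Max_less_iff) auto
  qed
  then show ?thesis
    unfolding gap_def using assms by (subst Min_gr_iff) auto
qed

text \<open>The mass on suboptimal actions costs at least the gap already in the first step, even if play is
  optimal afterwards.\<close>
lemma gap_mult_subopt_prob_le: "gap M * subopt_prob M \<pi> s \<le> value_error M \<pi>"
proof -
  have "gap M * subopt_prob M \<pi> s \<le> (\<Sum>a\<in>- opt_actions M s. pmf (\<pi> s) a * (opt_val M s - opt_Q M s a))"
    unfolding subopt_prob_def sum_distrib_left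
    by (intro sum_mono) (auto intro!: mult_right_mono gap_le simp: mult.commute[of _ "_ - _"])
  also have "\<dots> \<le> (\<Sum>a\<in>UNIV. pmf (\<pi> s) a * (opt_val M s - opt_Q M s a))"
    by (intro sum_mono2) (auto simp: opt_Q_le_opt_val)
  also have "\<dots> = opt_val M s - (\<Sum>a\<in>UNIV. pmf (\<pi> s) a * opt_Q M s a)"
    by (simp add: right_diff_distrib sum_subtractf sum_pmf_UNIV flip: sum_distrib_right)
  also have "\<dots> \<le> opt_val M s - val_fun M \<pi> s"
    unfolding val_fun_eq[OF valid] by (intro diff_left_mono sum_mono mult_left_mono Q_fun_le_opt) auto
  also have "\<dots> \<le> value_error M \<pi>"
    by (rule opt_val_minus_val_fun_le)
  finally show ?thesis .
qed

end

section \<open>Steep potentials on the unit interval\<close>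

locale steep_potential =
  fixes \<psi> :: "real \<Rightarrow> ereal"
  assumes potential: "mirror_potential \<psi>"
    and steep_0: "filterlim (ederiv \<psi>) at_bot (at_right 0)"
    and steep_1: "filterlim (ederiv \<psi>) at_top (at_left 1)"
    and differentiable: "\<forall>x\<in>interior (edom \<psi>). ederiv \<psi> differentiable (at x)"
    and curvature_pos: "\<forall>x\<in>interior (edom \<psi>). 0 < deriv (ederiv \<psi>) x"
begin

abbreviation f :: "real \<Rightarrow> real" where "f x \<equiv> real_of_ereal (\<psi> x)"
abbreviation g :: "real \<Rightarrow> real" where "g \<equiv> ederiv \<psi>"

lemma \<psi>_eq: "x \<in> edom \<psi> \<Longrightarrow> \<psi> x = ereal (f x)"
  using potential by (auto simp: mirror_potential_def edom_def ereal_real)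

lemma unit_interval_edom: "{0..1} \<subseteq> edom \<psi>"
  using potential by (simp add: mirror_potential_def)

lemma convex_combination:
  assumes "x \<in> edom \<psi>" "y \<in> edom \<psi>" "0 \<le> u" "0 \<le> v" "u + v = 1"
  shows "\<psi> (u * x + v * y) \<le> ereal (u * f x + v * f y)"
proof -
  have "(x, f x) \<in> eepigraph \<psi>" "(y, f y) \<in> eepigraph \<psi>"
    using \<psi>_eq[OF assms(1)] \<psi>_eq[OF assms(2)] by (simp_all add: eepigraph_def)
  moreover have "convex (eepigraph \<psi>)"
    using potential by (simp add: mirror_potential_def)
  ultimately have "u *\<^sub>R (x, f x) + v *\<^sub>R (y, f y) \<in> eepigraph \<psi>"
    using assms(3-5) by (simp only: convex_def)
  then show ?thesis
    by (simp add: eepigraph_def)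
qed

lemma convex_edom: "convex (edom \<psi>)"
proof (rule convexI)
  fix x y u v :: real
  assume "x \<in> edom \<psi>" "y \<in> edom \<psi>" "0 \<le> u" "0 \<le> v" "u + v = 1"
  then have "\<psi> (u * x + v * y) \<le> ereal (u * f x + v * f y)"
    by (rule convex_combination)
  then show "u *\<^sub>R x + v *\<^sub>R y \<in> edom \<psi>"
    by (auto simp: edom_def intro: le_less_trans)
qed

lemma convex_f: "convex_on (edom \<psi>) f"
proof (rule convex_onI)
  fix t x y :: real
  assume *: "0 < t" "t < 1" "x \<in> edom \<psi>" "y \<in> edom \<psi>"
  have "(1 - t) * x + t * y \<in> edom \<psi>"
    using convex_edom * by (auto simp: convex_alt)
  from ord_eq_le_trans[OF \<psi>_eq[OF this, symmetric] convex_combination]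
  have "ereal (f ((1 - t) * x + t * y)) \<le> ereal ((1 - t) * f x + t * f y)"
    using * by auto
  then show "f ((1 - t) *\<^sub>R x + t *\<^sub>R y) \<le> (1 - t) * f x + t * f y"
    by (simp only: ereal_less_eq real_scaleR_def)
qed (rule convex_edom)

text \<open>A point 0 or 1 in the interior would make \<open>\<psi>'\<close> continuous, hence bounded, near it, against
  steepness; convexity of the domain excludes all points beyond.\<close>
lemma interior_edom: "interior (edom \<psi>) = {0<..<1}"
proof -
  have sub: "{0<..<1} \<subseteq> interior (edom \<psi>)"
    using unit_interval_edom by (intro interior_maximal) auto
  have cont: "(g \<longlongrightarrow> g x) (at x)" if "x \<in> interior (edom \<psi>)" for x
    using differentiable that differentiable_imp_continuous_within[of g x UNIV] by (auto simp: continuous_within)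
  have not_0: "0 \<notin> interior (edom \<psi>)"
  proof
    assume "0 \<in> interior (edom \<psi>)"
    then have "(g \<longlongrightarrow> g 0) (at_right 0)"
      by (rule tendsto_within_subset[OF cont subset_UNIV])
    then show False
      using not_tendsto_and_filterlim_at_infinity[of "at_right (0::real)" g "g 0"] filterlim_at_bot_imp_at_infinity[OF steep_0]
      by simp
  qed
  have not_1: "1 \<notin> interior (edom \<psi>)"
  proof
    assume "1 \<in> interior (edom \<psi>)"
    then have "(g \<longlongrightarrow> g 1) (at_left 1)"
      by (rule tendsto_within_subset[OF cont subset_UNIV])
    then show False
      using not_tendsto_and_filterlim_at_infinity[of "at_left (1::real)" g "g 1"] filterlim_at_top_imp_at_infinity[OF steep_1]
      by simp
  qed
  have between: "c \<in> interior (edom \<psi>)"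
    if "a \<in> interior (edom \<psi>)" "d \<in> interior (edom \<psi>)" "a \<le> c" "c \<le> d" for a c d
  proof -
    have "is_interval (interior (edom \<psi>))"
      using convex_interior[OF convex_edom] by (simp add: is_interval_convex_1)
    then show ?thesis
      using that unfolding is_interval_1 by blast
  qed
  have half: "1 / 2 \<in> interior (edom \<psi>)"
    using sub by auto
  have "\<not> x \<le> 0" "\<not> 1 \<le> x" if "x \<in> interior (edom \<psi>)" for x
    using between[OF that half, of 0] between[OF half that, of 1] not_0 not_1 by auto
  then have "interior (edom \<psi>) \<subseteq> {0<..<1}"
    by (metis greaterThanLessThan_iff not_le subsetI)
  with sub show ?thesis
    by blast
qed

lemma has_derivative_f: "0 < x \<Longrightarrow> x < 1 \<Longrightarrow> (f has_real_derivative g x) (at x)"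
  using potential interior_edom
  by (auto simp: mirror_potential_def ederiv_def DERIV_deriv_iff_real_differentiable)

lemma has_derivative_g: "0 < x \<Longrightarrow> x < 1 \<Longrightarrow> (g has_real_derivative deriv g x) (at x)"
  using differentiable interior_edom by (simp add: DERIV_deriv_iff_real_differentiable)

text \<open>The point of tangency is interior, but \<open>y\<close> may be an endpoint: this is how boundary points of
  the simplex are compared with interior ones.\<close>
lemma tangent_below: "0 < x \<Longrightarrow> x < 1 \<Longrightarrow> 0 \<le> y \<Longrightarrow> y \<le> 1 \<Longrightarrow> f x + g x * (y - x) \<le> f y"
  using convex_on_imp_above_tangent[OF convex_f convex_connected[OF convex_edom], of x y "g x"]
    has_field_derivative_at_within[OF has_derivative_f, of x "edom \<psi>"] interior_edom unit_interval_edom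
  by auto

lemma g_strict_mono:
  assumes "0 < x" "x < y" "y < 1"
  shows "g x < g y"
proof (rule DERIV_pos_imp_increasing[OF assms(2)])
  fix z assume "x \<le> z" "z \<le> y"
  with assms show "\<exists>d. (g has_real_derivative d) (at z) \<and> 0 < d"
    using has_derivative_g[of z] curvature_pos interior_edom by auto
qed

lemma g_le_iff: "0 < x \<Longrightarrow> x < 1 \<Longrightarrow> 0 < y \<Longrightarrow> y < 1 \<Longrightarrow> g x \<le> g y \<longleftrightarrow> x \<le> y"
  using g_strict_mono[of x y] g_strict_mono[of y x] by (cases x y rule: linorder_cases) auto

lemma g_eq_iff: "0 < x \<Longrightarrow> x < 1 \<Longrightarrow> 0 < y \<Longrightarrow> y < 1 \<Longrightarrow> g x = g y \<longleftrightarrow> x = y"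
  using g_strict_mono[of x y] g_strict_mono[of y x] by (cases x y rule: linorder_cases) auto

lemma isCont_g: "0 < x \<Longrightarrow> x < 1 \<Longrightarrow> isCont g x"
  using has_derivative_g DERIV_isCont by blast

lemma g_surj: "\<exists>x. 0 < x \<and> x < 1 \<and> g x = c"
proof -
  have "eventually (\<lambda>x. g x \<le> c) (at_right 0)"
    using filterlim_at_bot[THEN iffD1, OF steep_0] by auto
  moreover have "eventually (\<lambda>x. x \<in> {0<..<1 / 2::real}) (at_right 0)"
    by (rule eventually_at_rightI[of _ "1 / 2"]) auto
  ultimately have "eventually (\<lambda>x. g x \<le> c \<and> x < 1 / 2 \<and> 0 < x) (at_right 0)"
    by eventually_elim auto
  then obtain l where l: "g l \<le> c" "l < 1 / 2" "0 < l"
    using eventually_happens'[of "at_right (0::real)"] by auto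
  have "eventually (\<lambda>x. c \<le> g x) (at_left 1)"
    using filterlim_at_top[THEN iffD1, OF steep_1] by auto
  moreover have "eventually (\<lambda>x. x \<in> {1 / 2<..<1::real}) (at_left 1)"
    by (rule eventually_at_leftI[of "1 / 2"]) auto
  ultimately have "eventually (\<lambda>x. c \<le> g x \<and> 1 / 2 < x \<and> x < 1) (at_left 1)"
    by eventually_elim auto
  then obtain h where h: "c \<le> g h" "1 / 2 < h" "h < 1"
    using eventually_happens'[of "at_left (1::real)"] by auto
  have "\<exists>x. l \<le> x \<and> x \<le> h \<and> g x = c"
    using l h by (intro IVT) (auto intro: isCont_g)
  then obtain x where "l \<le> x" "x \<le> h" "g x = c"
    by blast
  then show ?thesis
    using l h by (intro exI[of _ x]) auto
qed

lemma le_phi_inv: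
  assumes "0 < x" "x < 1" "c \<le> - g x"
  shows "x \<le> phi_inv \<psi> c"
proof -
  obtain z where z: "0 < z" "z < 1" "g z = - c"
    using g_surj by blast
  have "inj_on (\<lambda>x. - g x) {0<..<1}"
    by (auto simp: inj_on_def g_eq_iff)
  from inv_into_f_f[OF this, of z] have "phi_inv \<psi> c = z"
    using z by (simp add: phi_inv_def)
  then show ?thesis
    using assms z g_le_iff[of x z] by simp
qed

lemma le_chi_inv:
  assumes "0 < x" "x < 1" "c \<le> g (1 - x)"
  shows "x \<le> chi_inv \<psi> c"
proof -
  obtain z where z: "0 < z" "z < 1" "g z = c"
    using g_surj by blast
  have "inj_on (\<lambda>x. g (1 - x)) {0<..<1}"
    by (auto simp: inj_on_def g_eq_iff)
  from inv_into_f_f[OF this, of "1 - z"] have "chi_inv \<psi> c = 1 - z"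
    using z by (simp add: chi_inv_def)
  then show ?thesis
    using assms z g_le_iff[of z "1 - x"] by simp
qed

lemma phi_inv_pos: "0 < phi_inv \<psi> c"
proof -
  obtain z where z: "0 < z" "z < 1" "g z = - c"
    using g_surj by blast
  then show ?thesis
    using le_phi_inv[of z c] by simp
qed

lemma chi_inv_pos: "0 < chi_inv \<psi> c"
proof -
  obtain z where z: "0 < z" "z < 1" "g z = c"
    using g_surj by blast
  then show ?thesis
    using le_chi_inv[of "1 - z" c] by simp
qed

lemma g_increment_ge:
  assumes "0 < x" "x \<le> y" "y < 1" and L: "\<And>z. x \<le> z \<Longrightarrow> z \<le> y \<Longrightarrow> L \<le> deriv g z"
  shows "L * (y - x) \<le> g y - g x"
proof (cases "x = y")
  case False
  have "(g has_real_derivative deriv g z) (at z)" if "x \<le> z" "z \<le> y" for z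
    using that assms by (intro has_derivative_g) auto
  then obtain z where "x < z" "z < y" "g y - g x = (y - x) * deriv g z"
    using MVT2[of x y g "deriv g"] False assms(2) by auto
  then show ?thesis
    using L[of z] by (simp add: mult.commute)
qed simp

text \<open>Monotonicity replaces a linearized system of equations. If the dual variable of \<open>a\<close>
  increases by at most \<open>\<epsilon>\<close>, the curvature bound converts this into \<open>\<epsilon> / L\<close>. If it increases by
  more, the dual variables of all of \<open>A\<close> increase, hence all the coordinates do, and the increase at
  \<open>a\<close> is part of the increase of the total mass.\<close>
lemma primal_change_le:
  assumes fin: "finite A" and a: "a \<in> A"
    and range: "0 < lo" "hi < 1" "\<And>c. c \<in> A \<Longrightarrow> x c \<in> {lo..hi}" "\<And>c. c \<in> A \<Longrightarrow> y c \<in> {lo..hi}"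
    and L: "0 < L" "\<And>z. z \<in> {lo..hi} \<Longrightarrow> L \<le> deriv g z"
    and mass: "(\<Sum>c\<in>A. y c) - (\<Sum>c\<in>A. x c) \<le> \<beta>" "0 \<le> \<beta>"
    and dual: "\<And>c. c \<in> A \<Longrightarrow> g (y a) - g (y c) - (g (x a) - g (x c)) \<le> \<epsilon>" "0 \<le> \<epsilon>"
  shows "y a - x a \<le> \<beta> + \<epsilon> / L"
proof -
  have \<epsilon>L: "0 \<le> \<epsilon> / L"
    using L(1) dual(2) by simp
  consider "y a \<le> x a" | "x a < y a" "g (y a) - g (x a) \<le> \<epsilon>" | "x a < y a" "\<epsilon> < g (y a) - g (x a)"
    by linarith
  then show ?thesis
  proof cases
    case 1
    then show ?thesis
      using mass(2) \<epsilon>L by linarith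
  next
    case 2
    have "L * (y a - x a) \<le> g (y a) - g (x a)"
      using range(1,2) range(3,4)[OF a] 2(1) by (intro g_increment_ge L) auto
    then have "y a - x a \<le> \<epsilon> / L"
      using 2 L(1) by (simp add: pos_le_divide_eq mult.commute)
    then show ?thesis
      using mass(2) by linarith
  next
    case 3
    have "x c \<le> y c" if c: "c \<in> A" for c
    proof -
      have "g (x c) \<le> g (y c)"
        using dual(1)[OF c] 3 by linarith
      then show ?thesis
        using range(1,2) range(3,4)[OF c] by (subst (asm) g_le_iff) auto
    qed
    then have "y a - x a \<le> (\<Sum>c\<in>A. y c - x c)"
      using fin a by (intro member_le_sum) auto
    also have "\<dots> \<le> \<beta>"
      using mass(1) by (simp add: sum_subtractf)
    finally show ?thesis
      using \<epsilon>L by linarith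
  qed
qed

section \<open>A single mirror descent step\<close>

definition divergence :: "('a::finite \<Rightarrow> real) \<Rightarrow> ('a \<Rightarrow> real) \<Rightarrow> real" where
  "divergence p q = (\<Sum>a\<in>UNIV. f (p a) - f (q a) - g (q a) * (p a - q a))"

lemma divergence_nonneg:
  assumes "\<And>a. 0 < q a" "\<And>a. q a < 1" "\<And>a. 0 \<le> p a" "\<And>a. p a \<le> 1"
  shows "0 \<le> divergence p q"
  unfolding divergence_def using tangent_below assms by (intro sum_nonneg) (simp add: algebra_simps)

text \<open>The gradient is taken of an extended-valued sum, so the identity holds because moving one
  coordinate within \<open>(0, 1)\<close> keeps all the summands finite.\<close>
lemma gradient_mirror_map:
  assumes "\<And>a. 0 < q a" "\<And>a. q a < 1"
  shows "gradient (mirror_map \<psi>) q a = g (q a)"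
proof -
  have "real_of_ereal (mirror_map \<psi> (q(a := x))) = f x + (\<Sum>b\<in>UNIV - {a}. f (q b))" if "x \<in> {0<..<1}" for x
  proof -
    have "mirror_map \<psi> (q(a := x)) = (\<Sum>b\<in>UNIV. ereal (f ((q(a := x)) b)))"
      unfolding mirror_map_def using that assms unit_interval_edom
      by (intro sum.cong refl \<psi>_eq) (auto simp: less_imp_le subset_iff)
    also have "\<dots> = ereal (\<Sum>b\<in>UNIV. f ((q(a := x)) b))"
      by simp
    also have "(\<Sum>b\<in>UNIV. f ((q(a := x)) b)) = f x + (\<Sum>b\<in>UNIV - {a}. f (q b))"
      by (subst sum.remove[of _ a]) auto
    finally show ?thesis
      by (simp only: real_of_ereal.simps)
  qed
  moreover have "((\<lambda>x. f x + (\<Sum>b\<in>UNIV - {a}. f (q b))) has_real_derivative g (q a)) (at (q a))"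
    using has_derivative_f[OF assms] by (auto intro!: derivative_eq_intros)
  ultimately have "((\<lambda>x. real_of_ereal (mirror_map \<psi> (q(a := x)))) has_real_derivative g (q a)) (at (q a))"
    using assms by (subst DERIV_cong_ev[OF refl _ refl]) (auto intro!: eventually_nhds_in_open[THEN eventually_mono, of "{0<..<1}"])
  then show ?thesis
    unfolding gradient_def by (rule DERIV_imp_deriv)
qed

lemma bregman_mirror_map:
  assumes "\<And>a. 0 < q a" "\<And>a. q a < 1" "\<And>a. 0 \<le> p a" "\<And>a. p a \<le> 1"
  shows "bregman (mirror_map \<psi>) p q = ereal (divergence p q)"
proof -
  have h: "mirror_map \<psi> p = ereal (\<Sum>a\<in>UNIV. f (p a))" if "\<And>a. 0 \<le> p a" "\<And>a. p a \<le> 1" for p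
  proof -
    have "mirror_map \<psi> p = (\<Sum>a\<in>UNIV. ereal (f (p a)))"
      unfolding mirror_map_def using that unit_interval_edom
      by (intro sum.cong refl \<psi>_eq) (auto simp: subset_iff)
    then show ?thesis by simp
  qed
  show ?thesis
    using assms by (simp add: bregman_def h less_imp_le gradient_mirror_map divergence_def sum_subtractf)
qed

text \<open>The step size is absorbed into the linear payoff \<open>v\<close>.\<close>
definition is_pmd_step :: "('a::finite \<Rightarrow> real) \<Rightarrow> 'a pmf \<Rightarrow> 'a pmf \<Rightarrow> bool" where
  "is_pmd_step v q p \<longleftrightarrow> is_arg_max
     (\<lambda>p. ereal (\<Sum>a\<in>UNIV. pmf p a * v a) - bregman (mirror_map \<psi>) (pmf p) (pmf q)) (\<lambda>_. True) p"

lemma pmd_step_maximizes: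
  assumes "is_pmd_step v q p" "\<And>a. 0 < pmf q a" "\<And>a. pmf q a < 1"
  shows "(\<Sum>a\<in>UNIV. pmf p' a * v a) - divergence (pmf p') (pmf q)
    \<le> (\<Sum>a\<in>UNIV. pmf p a * v a) - divergence (pmf p) (pmf q)"
proof -
  have "bregman (mirror_map \<psi>) (pmf p') (pmf q) = ereal (divergence (pmf p') (pmf q))" for p'
    by (rule bregman_mirror_map) (use assms in \<open>auto simp: pmf_le_1\<close>)
  then show ?thesis
    using assms(1) by (auto simp: is_pmd_step_def is_arg_max_def not_less)
qed

text \<open>Moving mass \<open>t\<close> from \<open>b\<close> to \<open>a\<close> cannot improve on a maximizer. The tangents are taken at the
  shifted points, which are interior even if \<open>p\<close> is on the boundary; so the inequality serves both to show
  that maximizers are interior and, as \<open>t \<rightarrow> 0\<close>, to derive the first-order condition.\<close>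
lemma pmd_step_exchange:
  fixes p q :: "'a::finite pmf"
  assumes step: "is_pmd_step v q p" and q: "\<And>a. 0 < pmf q a" "\<And>a. pmf q a < 1"
    and ab: "a \<noteq> b" and t: "0 < t" "t < pmf p b"
  shows "v a - v b + g (pmf q a) - g (pmf q b) \<le> g (pmf p a + t) - g (pmf p b - t)"
proof -
  define w where "w = (pmf p)(a := pmf p a + t, b := pmf p b - t)"
  have sum_w: "(\<Sum>c\<in>UNIV. F c (w c)) = (\<Sum>c\<in>UNIV. F c (pmf p c))
      + (F a (pmf p a + t) - F a (pmf p a)) + (F b (pmf p b - t) - F b (pmf p b))"
    for F :: "'a \<Rightarrow> real \<Rightarrow> real"
  proof -
    have "(\<Sum>c\<in>UNIV. F c (w c) - F c (pmf p c)) = (\<Sum>c\<in>{a, b}. F c (w c) - F c (pmf p c))"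
      by (rule sum.mono_neutral_right) (auto simp: w_def)
    then show ?thesis
      using ab by (simp add: w_def sum_subtractf)
  qed
  have "pmf p a + pmf p b \<le> 1"
    by (rule pmf_add_le_1[OF ab])
  then have a1: "pmf p a + t < 1" and b1: "pmf p b - t < 1"
    using t pmf_le_1[of p b] by auto
  have "0 \<le> w c" for c
    using t by (simp add: w_def)
  moreover have "(\<Sum>c\<in>UNIV. w c) = 1"
    using sum_w[of "\<lambda>_ x. x"] by (simp add: sum_pmf_UNIV)
  ultimately obtain p' where p': "pmf p' = w"
    by (rule pmf_of_simplex_point)
  have "t * (v a - v b + g (pmf q a) - g (pmf q b))
      \<le> f (pmf p a + t) - f (pmf p a) + (f (pmf p b - t) - f (pmf p b))"
    using pmd_step_maximizes[OF step q, of p'] sum_w[of "\<lambda>c x. x * v c"]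
      sum_w[of "\<lambda>c x. f x - f (pmf q c) - g (pmf q c) * (x - pmf q c)"]
    unfolding p' divergence_def by (simp add: algebra_simps)
  also have "f (pmf p a + t) - f (pmf p a) \<le> t * g (pmf p a + t)"
    using tangent_below[of "pmf p a + t" "pmf p a"] t a1 by (simp add: add_nonneg_pos pmf_le_1 mult.commute)
  also have "f (pmf p b - t) - f (pmf p b) \<le> - t * g (pmf p b - t)"
    using tangent_below[of "pmf p b - t" "pmf p b"] t b1 by (simp add: pmf_le_1 mult.commute)
  finally have "t * (v a - v b + g (pmf q a) - g (pmf q b)) \<le> t * (g (pmf p a + t) - g (pmf p b - t))"
    by (simp add: algebra_simps)
  then show ?thesis
    using t by simp
qed

text \<open>If \<open>a\<close> had probability 0, the right-hand side of the exchange inequality would tend to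
  \<open>-\<infinity>\<close> as \<open>t \<rightarrow> 0\<close>, because \<open>\<psi>'(0\<^sup>+) = -\<infinity>\<close>.\<close>
lemma pmd_step_pos:
  assumes step: "is_pmd_step v q p" and q: "\<And>a. 0 < pmf q a" "\<And>a. pmf q a < 1"
  shows "0 < pmf p a"
proof (rule ccontr)
  assume "\<not> 0 < pmf p a"
  then have a0: "pmf p a = 0"
    using pmf_nonneg[of p a] by linarith
  obtain b where b: "b \<in> set_pmf p"
    using set_pmf_not_empty by fast
  then have b0: "0 < pmf p b"
    by (simp add: pmf_positive)
  with a0 have ab: "a \<noteq> b"
    by auto
  define K where "K = v a - v b + g (pmf q a) - g (pmf q b) + g (pmf p b / 2)"
  have "eventually (\<lambda>t. g t \<le> K - 1) (at_right 0)"
    using filterlim_at_bot[THEN iffD1, OF steep_0] by auto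
  moreover have "eventually (\<lambda>t. t \<in> {0<..<pmf p b / 2}) (at_right 0)"
    using b0 by (intro eventually_at_rightI[of _ "pmf p b / 2"]) auto
  ultimately have "eventually (\<lambda>t. g t \<le> K - 1 \<and> 0 < t \<and> t < pmf p b / 2) (at_right 0)"
    by eventually_elim auto
  then obtain t where t: "g t \<le> K - 1" "0 < t" "t < pmf p b / 2"
    using eventually_happens'[of "at_right (0::real)"] by auto
  have "K - g (pmf p b / 2) \<le> g t - g (pmf p b - t)"
    using pmd_step_exchange[OF step q ab, of t] t a0 by (simp add: K_def)
  moreover have "g (pmf p b / 2) \<le> g (pmf p b - t)"
    using t b0 pmf_le_1[of p b] by (subst g_le_iff) auto
  ultimately show False
    using t by linarith
qed

lemma pmd_step_first_order:
  fixes p q :: "'a::finite pmf"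
  assumes step: "is_pmd_step v q p" and q: "\<And>a. 0 < pmf q a" "\<And>a. pmf q a < 1"
  shows "g (pmf p a) - g (pmf p b) = g (pmf q a) - g (pmf q b) + (v a - v b)"
proof -
  have p: "0 < pmf p a" "pmf p a < 1" for a
    using pmd_step_pos[OF step q] pmf_less_1[OF q(2), of p] by auto
  have ineq: "v a - v b + g (pmf q a) - g (pmf q b) \<le> g (pmf p a) - g (pmf p b)" if "a \<noteq> b" for a b
  proof (rule tendsto_lowerbound)
    have "((\<lambda>t. g (pmf p a + t) - g (pmf p b - t)) \<longlongrightarrow> g (pmf p a + 0) - g (pmf p b - 0)) (at_right 0)"
      by (intro tendsto_diff isCont_tendsto_compose[of _ g] tendsto_add tendsto_const tendsto_ident_at)
         (simp_all add: isCont_g p)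
    then show "((\<lambda>t. g (pmf p a + t) - g (pmf p b - t)) \<longlongrightarrow> g (pmf p a) - g (pmf p b)) (at_right 0)"
      by simp
    show "eventually (\<lambda>t. v a - v b + g (pmf q a) - g (pmf q b) \<le> g (pmf p a + t) - g (pmf p b - t)) (at_right 0)"
      using p(1)[of b] pmd_step_exchange[OF step q that]
      by (intro eventually_at_rightI[of 0 "pmf p b"]) auto
  qed simp
  show ?thesis
    using ineq[of a b] ineq[of b a] by (cases "a = b") auto
qed

text \<open>The first-order condition says that \<open>v\<close> and the change of the dual variables differ by a
  constant, which pairs to zero with a difference of two probability vectors.\<close>
lemma pmd_step_three_point:
  fixes p q :: "'a::finite pmf"
  assumes step: "is_pmd_step v q p" and q: "\<And>a. 0 < pmf q a" "\<And>a. pmf q a < 1"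
  shows "(\<Sum>a\<in>UNIV. (pmf p' a - pmf p a) * v a)
    = divergence (pmf p') (pmf q) - divergence (pmf p') (pmf p) - divergence (pmf p) (pmf q)"
proof -
  \<comment> \<open>Any reference action will do to read off the multiplier \<open>c\<close>.\<close>
  define b :: 'a where "b = undefined"
  define c where "c = g (pmf p b) - g (pmf q b) - v b"
  have v: "v a = g (pmf p a) - g (pmf q a) - c" for a
    using pmd_step_first_order[OF step q, of a b] by (simp add: c_def)
  have "(\<Sum>a\<in>UNIV. (pmf p' a - pmf p a) * c) = 0"
    by (simp add: sum_subtractf sum_pmf_UNIV flip: sum_distrib_right)
  moreover have "(\<Sum>a\<in>UNIV. (pmf p' a - pmf p a) * v a) + (\<Sum>a\<in>UNIV. (pmf p' a - pmf p a) * c)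
     = divergence (pmf p') (pmf q) - divergence (pmf p') (pmf p) - divergence (pmf p) (pmf q)"
    unfolding divergence_def v sum.distrib[symmetric] sum_subtractf[symmetric]
    by (intro sum.cong) (auto simp: algebra_simps)
  ultimately show ?thesis
    by simp
qed

end

section \<open>Summability of the value errors\<close>

locale pmd = steep_potential \<psi> for \<psi> :: "real \<Rightarrow> ereal" +
  fixes M :: "('s::finite, 'a::finite) mdp" and \<eta> :: real and \<pi> :: "nat \<Rightarrow> 's \<Rightarrow> 'a pmf"
  assumes valid: "valid_mdp M"
    and nontrivial: "states_tilde M \<noteq> {}"
    and \<eta>_pos: "0 < \<eta>"
    and sequence: "pmd_sequence M \<psi> \<eta> \<pi>"
begin

abbreviation Q :: "nat \<Rightarrow> 's \<Rightarrow> 'a \<Rightarrow> real" where "Q k \<equiv> Q_fun M (\<pi> k)"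
abbreviation V :: "nat \<Rightarrow> 's \<Rightarrow> real" where "V k \<equiv> val_fun M (\<pi> k)"
abbreviation err :: "nat \<Rightarrow> real" where "err k \<equiv> value_error M (\<pi> k)"
abbreviation Opt :: "'s \<Rightarrow> 'a set" where "Opt s \<equiv> opt_actions M s"
abbreviation b :: "nat \<Rightarrow> 's \<Rightarrow> real" where "b k s \<equiv> subopt_prob M (\<pi> k) s"

lemma step: "is_pmd_step (\<lambda>a. \<eta> * Q k s a) (\<pi> k s) (\<pi> (Suc k) s)"
  using sequence by (simp add: pmd_sequence_def is_pmd_step_def sum_distrib_left mult.left_commute)

lemma iterate_pos: "0 < pmf (\<pi> k s) a" and iterate_less_1: "pmf (\<pi> k s) a < 1"
proof -
  have "(\<forall>a. 0 < pmf (\<pi> k s) a) \<and> (\<forall>a. pmf (\<pi> k s) a < 1)"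
  proof (induction k)
    case 0
    then show ?case
      using sequence interior_edom by (auto simp: pmd_sequence_def)
  next
    case (Suc k)
    then have "0 < pmf (\<pi> (Suc k) s) a" for a
      using pmd_step_pos[OF step] by blast
    moreover from this have "pmf (\<pi> (Suc k) s) a < 1" for a
      using Suc pmf_less_1[of "\<pi> k s" a "\<pi> (Suc k) s"] by blast
    ultimately show ?case
      by blast
  qed
  then show "0 < pmf (\<pi> k s) a" "pmf (\<pi> k s) a < 1"
    by auto
qed

lemma dual_step:
  "g (pmf (\<pi> (Suc k) s) a) - g (pmf (\<pi> (Suc k) s) c)
    = g (pmf (\<pi> k s) a) - g (pmf (\<pi> k s) c) + \<eta> * (Q k s a - Q k s c)"
  using pmd_step_first_order[OF step iterate_pos iterate_less_1, of k s a c] by (simp add: right_diff_distrib)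

lemma three_point:
  "\<eta> * (\<Sum>a\<in>UNIV. (pmf p a - pmf (\<pi> (Suc k) s) a) * Q k s a)
    = divergence (pmf p) (pmf (\<pi> k s)) - divergence (pmf p) (pmf (\<pi> (Suc k) s))
      - divergence (pmf (\<pi> (Suc k) s)) (pmf (\<pi> k s))"
  using pmd_step_three_point[OF step iterate_pos iterate_less_1, of p k s]
  by (simp add: sum_distrib_left mult.left_commute)

lemma divergence_iterate_nonneg: "0 \<le> divergence (pmf p) (pmf (\<pi> k s))"
  by (rule divergence_nonneg) (simp_all add: iterate_pos iterate_less_1 pmf_le_1)

text \<open>The three-point identity at \<open>p = \<pi>\<^sub>k\<close>, where the only positive term on its right vanishes.\<close>
lemma step_gain_nonneg: "0 \<le> (\<Sum>a\<in>UNIV. (pmf (\<pi> (Suc k) s) a - pmf (\<pi> k s) a) * Q k s a)"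
proof -
  have "\<eta> * (\<Sum>a\<in>UNIV. (pmf (\<pi> k s) a - pmf (\<pi> (Suc k) s) a) * Q k s a) \<le> 0"
    using divergence_iterate_nonneg[of "\<pi> k s" "Suc k" s] divergence_iterate_nonneg[of "\<pi> (Suc k) s" k s]
    unfolding three_point by (simp add: divergence_def)
  then have "(\<Sum>a\<in>UNIV. (pmf (\<pi> k s) a - pmf (\<pi> (Suc k) s) a) * Q k s a) \<le> 0"
    using \<eta>_pos by (simp add: mult_le_0_iff)
  then show ?thesis
    by (simp add: left_diff_distrib sum_subtractf)
qed

lemma V_mono: "V k s \<le> V (Suc k) s"
  using policy_improvement(1)[OF valid, of "\<pi> (Suc k)" "\<pi> k"] step_gain_nonneg by blast

lemma err_antimono: "k \<le> l \<Longrightarrow> err l \<le> err k"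
proof (induction rule: dec_induct)
  case (step n)
  have "err (Suc n) \<le> err n"
    unfolding value_error_def
  proof (rule sup_norm_le)
    fix s
    have "\<bar>opt_val M s - V (Suc n) s\<bar> \<le> \<bar>opt_val M s - V n s\<bar>"
      using V_mono[of n s] val_fun_le_opt[OF valid, of "\<pi> (Suc n)" s] by linarith
    also have "\<dots> \<le> sup_norm (\<lambda>s. opt_val M s - V n s)"
      by (rule abs_le_sup_norm)
    finally show "\<bar>opt_val M s - V (Suc n) s\<bar> \<le> sup_norm (\<lambda>s. opt_val M s - V n s)" .
  qed
  then show ?case
    using step.IH by simp
qed simp

text \<open>For one \<open>k\<close> the regret splits into the discounted regret of the successors under \<open>\<pi>o\<close> and
  the advantage \<open>\<langle>\<pi>o - \<pi>\<^sub>k, Q\<^sub>k\<rangle>\<close>. Inserting \<open>\<pi>\<^sub>k\<^sub>+\<^sub>1\<close> in the middle, one half of the advantage is bounded by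
  the decrease of the divergence from \<open>\<pi>o\<close> and the other by the increase of the value, and both
  telescope.\<close>
lemma regret_recursion:
  assumes opt: "val_fun M \<pi>o = opt_val M"
  shows "(\<Sum>k<n. opt_val M s - V k s)
    \<le> discount M * (\<Sum>a\<in>UNIV. pmf (\<pi>o s) a * next_value M (\<lambda>s. \<Sum>k<n. opt_val M s - V k s) s a)
      + (V n s - V 0 s) + (divergence (pmf (\<pi>o s)) (pmf (\<pi> 0 s)) - divergence (pmf (\<pi>o s)) (pmf (\<pi> n s))) / \<eta>"
proof (induction n)
  case 0
  then show ?case
    by (simp add: next_value_def)
next
  case (Suc n)
  let ?D = "\<lambda>k. divergence (pmf (\<pi>o s)) (pmf (\<pi> k s))"
  let ?P = "\<lambda>u. \<Sum>a\<in>UNIV. pmf (\<pi>o s) a * next_value M u s a"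
  let ?E = "\<lambda>k s. opt_val M s - V k s"
  have P_add: "?P (\<lambda>s. \<Sum>k<Suc n. ?E k s) = ?P (\<lambda>s. \<Sum>k<n. ?E k s) + ?P (?E n)"
    by (simp add: next_value_def distrib_left sum.distrib)
  have "?E n s = (\<Sum>a\<in>UNIV. (pmf (\<pi>o s) a - pmf (\<pi> n s) a) * Q n s a) + discount M * ?P (?E n)"
    using val_fun_diff[OF valid, of \<pi>o s "\<pi> n"] unfolding opt .
  also have "(\<Sum>a\<in>UNIV. (pmf (\<pi>o s) a - pmf (\<pi> n s) a) * Q n s a)
     = (\<Sum>a\<in>UNIV. (pmf (\<pi>o s) a - pmf (\<pi> (Suc n) s) a) * Q n s a)
     + (\<Sum>a\<in>UNIV. (pmf (\<pi> (Suc n) s) a - pmf (\<pi> n s) a) * Q n s a)"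
    by (simp add: left_diff_distrib sum_subtractf)
  also have "(\<Sum>a\<in>UNIV. (pmf (\<pi>o s) a - pmf (\<pi> (Suc n) s) a) * Q n s a) \<le> (?D n - ?D (Suc n)) / \<eta>"
    using three_point[of "\<pi>o s" n s] divergence_iterate_nonneg[of "\<pi> (Suc n) s" n s] \<eta>_pos
    by (simp add: pos_le_divide_eq mult.commute[of _ \<eta>])
  also have "(\<Sum>a\<in>UNIV. (pmf (\<pi> (Suc n) s) a - pmf (\<pi> n s) a) * Q n s a) \<le> V (Suc n) s - V n s"
    by (rule policy_improvement(2)[OF valid step_gain_nonneg])
  finally have "?E n s \<le> (?D n - ?D (Suc n)) / \<eta> + (V (Suc n) s - V n s) + discount M * ?P (?E n)"
    by simp
  then show ?case
    using Suc unfolding P_add by (simp add: distrib_left diff_divide_distrib)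
qed

text \<open>At a state where the partial sum of the regrets is largest, the successor average is at most
  that maximum, so the recursion bounds it by a constant over \<open>1 - \<gamma>\<close>, for every \<open>n\<close>. The constant is
  finite because the potential is finite at 0 and 1.\<close>
lemma summable_err: "summable err"
proof -
  obtain \<pi>o where opt: "val_fun M \<pi>o = opt_val M"
    by (rule optimal_policy_exists[OF valid])
  let ?D = "\<lambda>k s. divergence (pmf (\<pi>o s)) (pmf (\<pi> k s))"
  let ?E = "\<lambda>k s. opt_val M s - V k s"
  let ?S = "\<lambda>n s. \<Sum>k<n. ?E k s"
  have E_nonneg: "0 \<le> ?E k s" for k s
    using val_fun_le_opt[OF valid] by simp
  obtain s1 where s1: "\<And>s. ?E 0 s + ?D 0 s / \<eta> \<le> ?E 0 s1 + ?D 0 s1 / \<eta>"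
    using finite_maximizer_exists[of "\<lambda>s. ?E 0 s + ?D 0 s / \<eta>"] by blast
  define C where "C = (?E 0 s1 + ?D 0 s1 / \<eta>) / (1 - discount M)"
  have S_le: "?S n s \<le> C" for n s
  proof -
    obtain s0 where s0: "\<And>s. ?S n s \<le> ?S n s0"
      using finite_maximizer_exists[of "?S n"] by blast
    have "(\<Sum>a\<in>UNIV. pmf (\<pi>o s0) a * next_value M (?S n) s0 a) \<le> ?S n s0"
      unfolding next_value_def by (intro weighted_mean_le s0)
    then have "discount M * (\<Sum>a\<in>UNIV. pmf (\<pi>o s0) a * next_value M (?S n) s0 a) \<le> discount M * ?S n s0"
      by (rule mult_left_mono) (rule discount_bounds[OF valid])
    moreover have "(?D 0 s0 - ?D n s0) / \<eta> \<le> ?D 0 s0 / \<eta>"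
      using divergence_iterate_nonneg[where p = "\<pi>o s0" and k = n and s = s0] \<eta>_pos by (simp add: divide_right_mono)
    moreover have "0 \<le> ?E n s0"
      by (rule E_nonneg)
    ultimately have "?S n s0 \<le> discount M * ?S n s0 + (?E 0 s1 + ?D 0 s1 / \<eta>)"
      using regret_recursion[OF opt, where n = n and s = s0] s1[of s0] by linarith
    then have "?S n s0 * (1 - discount M) \<le> ?E 0 s1 + ?D 0 s1 / \<eta>"
      by (simp add: algebra_simps)
    then have "?S n s0 \<le> C"
      using discount_bounds[OF valid] by (simp add: C_def pos_le_divide_eq)
    then show ?thesis
      using s0[of s] by linarith
  qed
  have err_le: "err k \<le> (\<Sum>s\<in>UNIV. ?E k s)" for k
    unfolding value_error_def
  proof (rule sup_norm_le)
    fix s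
    have "?E k s \<le> (\<Sum>s\<in>UNIV. ?E k s)"
      by (rule member_le_sum) (use E_nonneg in auto)
    then show "\<bar>?E k s\<bar> \<le> (\<Sum>s\<in>UNIV. ?E k s)"
      using E_nonneg by simp
  qed
  show ?thesis
  proof (rule summableI_nonneg_bounded)
    fix n
    have "(\<Sum>k<n. err k) \<le> (\<Sum>k<n. \<Sum>s\<in>UNIV. ?E k s)"
      by (intro sum_mono err_le)
    also have "\<dots> = (\<Sum>s\<in>UNIV. ?S n s)"
      by (rule sum.swap)
    also have "\<dots> \<le> (\<Sum>s\<in>(UNIV :: 's set). C)"
      by (intro sum_mono S_le)
    finally show "(\<Sum>k<n. err k) \<le> (\<Sum>s\<in>(UNIV :: 's set). C)" .
  qed (rule value_error_nonneg[OF valid])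
qed

lemma err_tendsto_0: "err \<longlonglongrightarrow> 0"
  by (rule summable_LIMSEQ_zero[OF summable_err])

lemma err_le_after_T_iter:
  assumes "0 < \<sigma>" "T_iter M \<pi> \<sigma> \<le> k"
  shows "err k \<le> \<sigma>"
proof -
  have "eventually (\<lambda>k. err k < \<sigma>) sequentially"
    using order_tendstoD(2)[OF err_tendsto_0 assms(1)] .
  then have "\<exists>k. err k \<le> \<sigma>"
    by (auto simp: eventually_sequentially intro: less_imp_le)
  then have "err (T_iter M \<pi> \<sigma>) \<le> \<sigma>"
    unfolding T_iter_def by (rule LeastI_ex)
  then show ?thesis
    using err_antimono[OF assms(2)] by linarith
qed

lemma b_nonneg: "0 \<le> b k s"
  unfolding subopt_prob_def by (intro sum_nonneg) auto

lemma b_tendsto_0: "(\<lambda>k. b k s) \<longlonglongrightarrow> 0"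
proof (rule tendsto_sandwich[OF _ _ tendsto_const])
  have "b k s \<le> err k / gap M" for k
    using gap_mult_subopt_prob_le[OF valid, of "\<pi> k" s] gap_pos[OF valid nontrivial]
    by (simp add: pos_le_divide_eq mult.commute)
  then show "eventually (\<lambda>k. b k s \<le> err k / gap M) sequentially"
    by simp
  show "(\<lambda>k. err k / gap M) \<longlonglongrightarrow> 0"
    using tendsto_divide_zero[OF err_tendsto_0] .
qed (simp add: b_nonneg)

lemma sum_Opt: "(\<Sum>a\<in>Opt s. pmf (\<pi> k s) a) = 1 - b k s"
  using sum.subset_diff[of "Opt s" UNIV "pmf (\<pi> k s)"] sum_pmf_UNIV[of "\<pi> k s"]
  by (simp add: subopt_prob_def Compl_eq_Diff_UNIV)

lemma iterate_le_b: "a \<notin> Opt s \<Longrightarrow> pmf (\<pi> k s) a \<le> b k s"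
  unfolding subopt_prob_def by (rule member_le_sum) auto

section \<open>Decay of the suboptimal probability\<close>

text \<open>The base case unfolds the constant \<open>C\<^sub>1\<close>. In a step, the action value of \<open>a\<close> is within
  \<open>\<sigma>\<close> of the optimal value and that of \<open>c\<close> lies a gap below it.\<close>
lemma dual_gap_growth:
  assumes \<sigma>: "0 < \<sigma>" and k: "T_iter M \<pi> \<sigma> \<le> k" and a: "a \<in> Opt s" and c: "c \<notin> Opt s"
  shows "real k * (\<eta> * (gap M - 2 * \<sigma>)) + C1 M \<psi> \<eta> \<pi> \<sigma> \<le> g (pmf (\<pi> k s) a) - g (pmf (\<pi> k s) c)"
  using k
proof (induction rule: dec_induct)
  case base
  let ?T = "T_iter M \<pi> \<sigma>"
  have "s \<in> states_tilde M"
    using c by (auto simp: states_tilde_def)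
  then have "C1 M \<psi> \<eta> \<pi> \<sigma> \<le> G_gap M \<psi> \<pi> ?T s - \<eta> * (gap M - 2 * \<sigma>) * real ?T"
    unfolding C1_def by (intro Min_le) auto
  moreover have "(MIN a\<in>Opt s. g (pmf (\<pi> ?T s) a)) \<le> g (pmf (\<pi> ?T s) a)"
    using a by (intro Min_le) auto
  moreover have "g (pmf (\<pi> ?T s) c) \<le> (MAX a\<in>- Opt s. g (pmf (\<pi> ?T s) a))"
    using c by (intro Max_ge) auto
  ultimately show ?case
    unfolding G_gap_def by (simp add: mult.commute[of "real ?T"])
next
  case (step k)
  have "opt_val M s - \<sigma> \<le> Q k s a"
    using opt_Q_minus_Q_fun_le[OF valid, of s a "\<pi> k"] err_le_after_T_iter[OF \<sigma> step.hyps(1)] a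
    by (simp add: opt_actions_def)
  moreover have "Q k s c \<le> opt_val M s - gap M"
    using Q_fun_le_opt[OF valid, of "\<pi> k" s c] gap_le[OF valid c] by linarith
  ultimately have "gap M - 2 * \<sigma> \<le> Q k s a - Q k s c"
    using \<sigma> by linarith
  then have "\<eta> * (gap M - 2 * \<sigma>) \<le> \<eta> * (Q k s a - Q k s c)"
    using \<eta>_pos by simp
  then show ?case
    using step.IH unfolding dual_step by (simp add: distrib_right)
qed

text \<open>If two numbers differ by at least \<open>2y\<close>, the larger is at least \<open>y\<close> or the smaller is at most
  \<open>-y\<close>: either the optimal action is nearly certain or the suboptimal one nearly excluded.\<close>
lemma subopt_prob_decay:
  assumes \<sigma>: "0 < \<sigma>" and k: "T_iter M \<pi> \<sigma> \<le> k"
  defines "y \<equiv> real k * (\<eta> * (gap M - 2 * \<sigma>) / 2) + C1 M \<psi> \<eta> \<pi> \<sigma> / 2"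
  shows "b k s \<le> real CARD('a) * (phi_inv \<psi> y + chi_inv \<psi> y)"
proof -
  obtain a where a: "a \<in> Opt s"
    using opt_actions_nonempty[OF valid, of s] by blast
  have le: "pmf (\<pi> k s) c \<le> phi_inv \<psi> y + chi_inv \<psi> y" if c: "c \<notin> Opt s" for c
  proof -
    have "2 * y \<le> g (pmf (\<pi> k s) a) - g (pmf (\<pi> k s) c)"
      using dual_gap_growth[OF \<sigma> k a c] by (simp add: y_def)
    then consider "y \<le> - g (pmf (\<pi> k s) c)" | "y \<le> g (pmf (\<pi> k s) a)"
      by linarith
    then show ?thesis
    proof cases
      case 1
      then have "pmf (\<pi> k s) c \<le> phi_inv \<psi> y"
        by (rule le_phi_inv[OF iterate_pos iterate_less_1])
      then show ?thesis
        using chi_inv_pos[of y] by linarith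
    next
      case 2
      then have "1 - pmf (\<pi> k s) a \<le> chi_inv \<psi> y"
        by (intro le_chi_inv) (simp_all add: iterate_pos iterate_less_1)
      moreover have "pmf (\<pi> k s) a + pmf (\<pi> k s) c \<le> 1"
        using a c by (intro pmf_add_le_1) auto
      ultimately show ?thesis
        using phi_inv_pos[of y] by linarith
    qed
  qed
  have "b k s \<le> real (card (- Opt s)) * (phi_inv \<psi> y + chi_inv \<psi> y)"
    unfolding subopt_prob_def by (rule sum_bounded_above) (use le in auto)
  also have "\<dots> \<le> real CARD('a) * (phi_inv \<psi> y + chi_inv \<psi> y)"
    using phi_inv_pos[of y] chi_inv_pos[of y] by (intro mult_right_mono) (auto intro: card_mono)
  finally show ?thesis .
qed

lemma unique_optimal_action_limit:
  assumes "Opt s = {a}"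
  shows "(\<lambda>k. pmf (\<pi> k s) c) \<longlonglongrightarrow> pmf (return_pmf a) c"
    and "\<bar>pmf (\<pi> k s) c - pmf (return_pmf a) c\<bar> \<le> b k s"
proof -
  have bound: "\<bar>pmf (\<pi> k s) c - pmf (return_pmf a) c\<bar> \<le> b k s" for k
    using sum_Opt[where s = s and k = k] iterate_le_b[where a = c and s = s and k = k] b_nonneg[of k s] assms
    by (cases "c = a") (auto simp: indicator_def)
  then show "\<bar>pmf (\<pi> k s) c - pmf (return_pmf a) c\<bar> \<le> b k s" .
  have "(\<lambda>k. pmf (\<pi> k s) c - pmf (return_pmf a) c) \<longlonglongrightarrow> 0"
    using bound by (intro Lim_null_comparison[OF _ b_tendsto_0[of s]]) (simp del: pmf_return)
  then show "(\<lambda>k. pmf (\<pi> k s) c) \<longlonglongrightarrow> pmf (return_pmf a) c"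
    by (rule LIM_zero_cancel)
qed

end

section \<open>Convergence of the policies\<close>

text \<open>The windows must depend on the limiting policy only, and must contain the iterates from some
  point on, not just their limit. With \<open>m\<close> the least positive probability in \<open>p\<close>, and at least two
  actions in its support, the positive probabilities lie in \<open>[m, 1 - m]\<close>; half of \<open>m\<close> is given away
  to make this a neighbourhood inside \<open>(0, 1)\<close>.\<close>
definition curvature_window :: "'a pmf \<Rightarrow> real set" where
  "curvature_window p = {Min (pmf p ` set_pmf p) / 2 .. 1 - Min (pmf p ` set_pmf p) / 2}"

definition curvature_sup :: "'a pmf \<Rightarrow> (real \<Rightarrow> real) \<Rightarrow> real" where
  "curvature_sup p w = (SUP x\<in>curvature_window p. w x)"

definition curvature_inf :: "'a pmf \<Rightarrow> (real \<Rightarrow> real) \<Rightarrow> real" where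
  "curvature_inf p w = (INF x\<in>curvature_window p. w x)"

locale smooth_pmd = pmd +
  assumes curvature_cont: "continuous_on (interior (edom \<psi>)) (deriv (ederiv \<psi>))"
begin

lemma curvature_extrema:
  assumes "0 < m" "m \<le> 1 / 2"
  defines "I \<equiv> {m..1 - m}"
  shows "0 < (INF x\<in>I. deriv g x)" "(INF x\<in>I. deriv g x) \<le> (SUP x\<in>I. deriv g x)"
    "\<And>z. z \<in> I \<Longrightarrow> (INF x\<in>I. deriv g x) \<le> deriv g z"
proof -
  have I: "I \<subseteq> {0<..<1}" "I \<noteq> {}" "compact I"
    using assms by (auto simp: I_def)
  have cont: "continuous_on I (deriv g)"
    using curvature_cont I(1) unfolding interior_edom by (rule continuous_on_subset)
  have img: "compact (deriv g ` I)" "deriv g ` I \<noteq> {}"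
    using compact_continuous_image[OF cont I(3)] I(2) by auto
  have bdd: "bdd_below (deriv g ` I)" "bdd_above (deriv g ` I)"
    using compact_imp_bounded[OF img(1)] by (simp_all add: bounded_imp_bdd_below bounded_imp_bdd_above)
  show le: "(INF x\<in>I. deriv g x) \<le> deriv g z" if "z \<in> I" for z
    using that by (rule cINF_lower[OF bdd(1)])
  have "(INF x\<in>I. deriv g x) \<in> deriv g ` I"
    using img bdd(1) by (intro closed_contains_Inf compact_imp_closed)
  then show "0 < (INF x\<in>I. deriv g x)"
    using curvature_pos I(1) unfolding interior_edom by auto
  obtain z where z: "z \<in> I"
    using I(2) by blast
  show "(INF x\<in>I. deriv g x) \<le> (SUP x\<in>I. deriv g x)"
    using le[OF z] cSUP_upper[OF z bdd(2)] by linarith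
qed

definition tail :: "nat \<Rightarrow> real" where
  "tail k = (\<Sum>t. err (t + k))"

lemma tail_nonneg: "0 \<le> tail k"
  unfolding tail_def using summable_ignore_initial_segment[OF summable_err]
  by (intro suminf_nonneg) (simp_all add: value_error_nonneg[OF valid])

lemma tail_tendsto_0: "tail \<longlonglongrightarrow> 0"
proof (rule LIMSEQ_I)
  fix r :: real assume "0 < r"
  then show "\<exists>N. \<forall>n\<ge>N. norm (tail n - 0) < r"
    using suminf_exist_split[OF _ summable_err] by (simp add: tail_def)
qed

lemma sum_err_le_tail: "(\<Sum>t=k..<l. err t) \<le> tail k"
proof (cases "k \<le> l")
  case True
  have "(\<Sum>t=k..<l. err t) = (\<Sum>t<l - k. err (t + k))"
    using sum.shift_bounds_nat_ivl[of err 0 k "l - k"] True by (simp add: lessThan_atLeast0)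
  also have "\<dots> \<le> tail k"
    unfolding tail_def using summable_ignore_initial_segment[OF summable_err]
    by (intro sum_le_suminf) (simp_all add: value_error_nonneg[OF valid])
  finally show ?thesis .
qed (simp add: tail_nonneg)

text \<open>Two optimal actions have the same optimal action value, and the current action values fall short of
  it by at most the value error.\<close>
lemma optimal_dual_drift:
  assumes "a \<in> Opt s" "c \<in> Opt s" "k \<le> l"
  shows "\<bar>(g (pmf (\<pi> l s) a) - g (pmf (\<pi> l s) c)) - (g (pmf (\<pi> k s) a) - g (pmf (\<pi> k s) c))\<bar> \<le> \<eta> * tail k"
proof -
  have "\<bar>(g (pmf (\<pi> l s) a) - g (pmf (\<pi> l s) c)) - (g (pmf (\<pi> k s) a) - g (pmf (\<pi> k s) c))\<bar>
     \<le> \<eta> * (\<Sum>t=k..<l. err t)"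
    using assms(3)
  proof (induction rule: dec_induct)
    case (step n)
    have "opt_Q M s a = opt_val M s" "opt_Q M s c = opt_val M s"
      using assms by (simp_all add: opt_actions_def)
    then have "\<bar>Q n s a - Q n s c\<bar> \<le> err n"
      using opt_Q_minus_Q_fun_le[OF valid, of s a "\<pi> n"] opt_Q_minus_Q_fun_le[OF valid, of s c "\<pi> n"]
        Q_fun_le_opt[OF valid, of "\<pi> n" s a] Q_fun_le_opt[OF valid, of "\<pi> n" s c] by linarith
    then have "\<bar>\<eta> * (Q n s a - Q n s c)\<bar> \<le> \<eta> * err n"
      using \<eta>_pos by (simp add: abs_mult)
    then show ?case
      using step unfolding dual_step by (simp add: distrib_left)
  qed simp
  also have "\<dots> \<le> \<eta> * tail k"
    using \<eta>_pos sum_err_le_tail by simp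
  finally show ?thesis .
qed

text \<open>By pigeonhole some optimal action keeps at least the probability \<open>1 / (2n)\<close>, with \<open>n\<close> the number of
  optimal actions, once the suboptimal mass is below one half. Bounded dual differences pass a lower bound on
  to all the optimal actions, and as there are two or more this also bounds each away from 1.\<close>
lemma optimal_iterates_bounded_away:
  assumes gt1: "1 < card (Opt s)"
  obtains m K where "0 < m" "m \<le> 1 / 2" "\<And>k a. K \<le> k \<Longrightarrow> a \<in> Opt s \<Longrightarrow> pmf (\<pi> k s) a \<in> {m..1 - m}"
proof -
  let ?d = "\<lambda>k a c. g (pmf (\<pi> k s) a) - g (pmf (\<pi> k s) c)"
  define n where "n = real (card (Opt s))"
  have n: "1 < n"
    using gt1 by (simp add: n_def)
  define B where "B = (\<Sum>(a, c)\<in>Opt s \<times> Opt s. \<bar>?d 0 a c\<bar>) + \<eta> * tail 0"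
  have B: "?d k a c \<le> B" if "a \<in> Opt s" "c \<in> Opt s" for k a c
  proof -
    have "\<bar>?d 0 a c\<bar> \<le> (\<Sum>(a, c)\<in>Opt s \<times> Opt s. \<bar>?d 0 a c\<bar>)"
      using member_le_sum[of "(a, c)" "Opt s \<times> Opt s" "\<lambda>(a, c). \<bar>?d 0 a c\<bar>"] that by auto
    then show ?thesis
      using optimal_dual_drift[OF that, of 0 k] by (simp add: B_def)
  qed
  have "eventually (\<lambda>k. b k s < 1 / 2) sequentially"
    by (rule order_tendstoD(2)[OF b_tendsto_0]) simp
  then obtain K where K: "\<And>k. K \<le> k \<Longrightarrow> b k s < 1 / 2"
    by (auto simp: eventually_sequentially)
  obtain m where m: "0 < m" "m < 1" "g m = g (1 / (2 * n)) - B"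
    using g_surj by blast
  have lower: "m \<le> pmf (\<pi> k s) a" if k: "K \<le> k" and a: "a \<in> Opt s" for k a
  proof -
    have "\<exists>c\<in>Opt s. 1 / (2 * n) \<le> pmf (\<pi> k s) c"
    proof (rule ccontr)
      assume "\<not> ?thesis"
      then have "(\<Sum>c\<in>Opt s. pmf (\<pi> k s) c) \<le> real (card (Opt s)) * (1 / (2 * n))"
        by (intro sum_bounded_above) auto
      also have "\<dots> = 1 / 2"
        using n gt1 by (auto simp: n_def)
      finally show False
        using K[OF k] unfolding sum_Opt by simp
    qed
    then obtain c where c: "c \<in> Opt s" "1 / (2 * n) \<le> pmf (\<pi> k s) c"
      by blast
    then have "g (1 / (2 * n)) \<le> g (pmf (\<pi> k s) c)"
      using n iterate_pos iterate_less_1 by (subst g_le_iff) (auto simp: field_simps)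
    then have "g m \<le> g (pmf (\<pi> k s) a)"
      using B[OF c(1) a, of k] m(3) by linarith
    then show ?thesis
      using m iterate_pos iterate_less_1 by (subst (asm) g_le_iff) auto
  qed
  have two: "\<exists>c\<in>Opt s. c \<noteq> a" for a
  proof (rule ccontr)
    assume "\<not> ?thesis"
    then have "Opt s \<subseteq> {a}"
      by auto
    then have "card (Opt s) \<le> 1"
      using card_mono[of "{a}" "Opt s"] by simp
    then show False
      using gt1 by simp
  qed
  have range: "pmf (\<pi> k s) a \<in> {m..1 - m}" if k: "K \<le> k" and a: "a \<in> Opt s" for k a
  proof -
    obtain c where c: "c \<in> Opt s" "c \<noteq> a"
      using two by blast
    then show ?thesis
      using lower[OF k a] lower[OF k c(1)] pmf_add_le_1[OF c(2), of "\<pi> k s"] by simp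
  qed
  obtain a where "a \<in> Opt s"
    using opt_actions_nonempty[OF valid] by blast
  then have "m \<le> 1 / 2"
    using range[of K a] by simp
  then show ?thesis
    using that m(1) range by blast
qed

text \<open>The total mass on the optimal actions changes by the change of the suboptimal probability; this
  feeds the sensitivity bound, once in each direction.\<close>
lemma iterates_close:
  assumes m: "0 < m" "m \<le> 1 / 2"
    and range: "\<And>k a. K \<le> k \<Longrightarrow> a \<in> Opt s \<Longrightarrow> pmf (\<pi> k s) a \<in> {m..1 - m}"
    and kl: "K \<le> k" "k \<le> l" and a: "a \<in> Opt s"
  shows "\<bar>pmf (\<pi> l s) a - pmf (\<pi> k s) a\<bar> \<le> \<bar>b l s - b k s\<bar> + \<eta> * tail k / (INF x\<in>{m..1 - m}. deriv g x)"
proof -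
  note ext = curvature_extrema[OF m]
  have tail: "0 \<le> \<eta> * tail k"
    using \<eta>_pos tail_nonneg by simp
  have l: "K \<le> l"
    using kl by simp
  have "pmf (\<pi> l s) a - pmf (\<pi> k s) a \<le> \<bar>b l s - b k s\<bar> + \<eta> * tail k / (INF x\<in>{m..1 - m}. deriv g x)"
    by (rule primal_change_le[of "Opt s" a m "1 - m"])
       (use a m range[OF kl(1)] range[OF l] ext tail optimal_dual_drift[OF a _ kl(2)] in \<open>auto simp: sum_Opt abs_le_iff\<close>)
  moreover have "pmf (\<pi> k s) a - pmf (\<pi> l s) a \<le> \<bar>b l s - b k s\<bar> + \<eta> * tail k / (INF x\<in>{m..1 - m}. deriv g x)"
    by (rule primal_change_le[of "Opt s" a m "1 - m"])
       (use a m range[OF kl(1)] range[OF l] ext tail optimal_dual_drift[OF a _ kl(2)] in \<open>auto simp: sum_Opt abs_le_iff\<close>)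
  ultimately show ?thesis
    by linarith
qed

lemma suboptimal_iterate_tendsto_0:
  assumes "a \<notin> Opt s"
  shows "(\<lambda>k. pmf (\<pi> k s) a) \<longlonglongrightarrow> 0"
  by (rule tendsto_sandwich[OF _ _ tendsto_const b_tendsto_0[of s]]) (simp_all add: iterate_le_b[OF assms])

lemma optimal_iterates_Cauchy:
  assumes gt1: "1 < card (Opt s)" and a: "a \<in> Opt s"
  shows "Cauchy (\<lambda>k. pmf (\<pi> k s) a)"
proof -
  obtain m K where m: "0 < m" "m \<le> 1 / 2"
    and range: "\<And>k a. K \<le> k \<Longrightarrow> a \<in> Opt s \<Longrightarrow> pmf (\<pi> k s) a \<in> {m..1 - m}"
    using optimal_iterates_bounded_away[OF gt1] by blast
  let ?L = "INF x\<in>{m..1 - m}. deriv g x"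
  show ?thesis
  proof (rule CauchyI')
    fix e :: real assume e: "0 < e"
    have "(\<lambda>k. \<eta> * tail k / ?L) \<longlonglongrightarrow> \<eta> * 0 / ?L"
      using curvature_extrema(1)[OF m] by (intro tendsto_intros tail_tendsto_0) simp
    then have "eventually (\<lambda>k. \<eta> * tail k / ?L < e / 2) sequentially"
      using e by (intro order_tendstoD(2)) auto
    moreover have "eventually (\<lambda>k. b k s < e / 2) sequentially"
      using e by (intro order_tendstoD(2)[OF b_tendsto_0]) simp
    ultimately have "eventually (\<lambda>k. \<eta> * tail k / ?L < e / 2 \<and> b k s < e / 2 \<and> K \<le> k) sequentially"
      using eventually_ge_at_top[of K] by eventually_elim auto
    then obtain N where N: "\<And>k. N \<le> k \<Longrightarrow> \<eta> * tail k / ?L < e / 2 \<and> b k s < e / 2 \<and> K \<le> k"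
      by (auto simp: eventually_sequentially)
    have "dist (pmf (\<pi> k s) a) (pmf (\<pi> l s) a) < e" if "N \<le> k" "k < l" for k l
    proof -
      have "\<bar>pmf (\<pi> l s) a - pmf (\<pi> k s) a\<bar> \<le> \<bar>b l s - b k s\<bar> + \<eta> * tail k / ?L"
        using N[of k] that by (intro iterates_close[OF m _ _ _ a, where K = K] range) auto
      then show ?thesis
        using N[of k] N[of l] that b_nonneg[of k s] b_nonneg[of l s] unfolding dist_real_def by linarith
    qed
    then show "\<exists>N. \<forall>k\<ge>N. \<forall>l>k. dist (pmf (\<pi> k s) a) (pmf (\<pi> l s) a) < e"
      by blast
  qed
qed

lemma iterates_converge: "\<exists>p. \<forall>a. (\<lambda>k. pmf (\<pi> k s) a) \<longlonglongrightarrow> pmf p a"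
proof (cases "card (Opt s) = 1")
  case True
  then obtain a where "Opt s = {a}"
    by (auto simp: card_1_singleton_iff)
  then show ?thesis
    using unique_optimal_action_limit(1) by blast
next
  case False
  moreover have "card (Opt s) \<noteq> 0"
    using opt_actions_nonempty[OF valid] by simp
  ultimately have gt1: "1 < card (Opt s)"
    by linarith
  have "\<exists>x. (\<lambda>k. pmf (\<pi> k s) a) \<longlonglongrightarrow> x" for a
  proof (cases "a \<in> Opt s")
    case True
    then show ?thesis
      using optimal_iterates_Cauchy[OF gt1] by (simp add: real_Cauchy_convergent flip: convergent_def)
  next
    case False
    then show ?thesis
      using suboptimal_iterate_tendsto_0 by blast
  qed
  then obtain w where w: "\<And>a. (\<lambda>k. pmf (\<pi> k s) a) \<longlonglongrightarrow> w a"
    by metis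
  have "0 \<le> w a" for a
    by (rule tendsto_lowerbound[OF w]) auto
  moreover have "(\<Sum>a\<in>UNIV. w a) = 1"
  proof (rule LIMSEQ_unique)
    show "(\<lambda>k. \<Sum>a\<in>UNIV. pmf (\<pi> k s) a) \<longlonglongrightarrow> (\<Sum>a\<in>UNIV. w a)"
      by (intro tendsto_sum w)
    show "(\<lambda>k. \<Sum>a\<in>UNIV. pmf (\<pi> k s) a) \<longlonglongrightarrow> 1"
      by (simp add: sum_pmf_UNIV)
  qed
  ultimately obtain p where "pmf p = w"
    by (rule pmf_of_simplex_point)
  then show ?thesis
    using w by auto
qed

text \<open>The comparison of iterates bounds the distance by \<open>b + \<eta> tail / L\<close>. Since \<open>L \<le> U\<close>, the
  coefficients only grow in passing to the stated form.\<close>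
lemma multiple_optimal_actions_rate:
  assumes gt1: "1 < card (Opt s)" and lim: "\<And>a. (\<lambda>k. pmf (\<pi> k s) a) \<longlonglongrightarrow> pmf p a"
  defines "U \<equiv> curvature_sup p (deriv g)" and "L \<equiv> curvature_inf p (deriv g)"
  shows "0 < U" "0 < L"
    "\<exists>K. \<forall>k\<ge>K. sup_norm (\<lambda>a. pmf (\<pi> k s) a - pmf p a) \<le> U / L * b k s + 2 * \<eta> * U / L\<^sup>2 * tail k"
proof -
  obtain m0 K0 where m0: "0 < m0" "m0 \<le> 1 / 2"
    and range0: "\<And>k a. K0 \<le> k \<Longrightarrow> a \<in> Opt s \<Longrightarrow> pmf (\<pi> k s) a \<in> {m0..1 - m0}"
    using optimal_iterates_bounded_away[OF gt1] by blast
  have p_Opt: "m0 \<le> pmf p a" if "a \<in> Opt s" for a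
    by (rule tendsto_lowerbound[OF lim]) (use range0 that in \<open>auto simp: eventually_sequentially\<close>)
  have p_zero: "pmf p a = 0" if "a \<notin> Opt s" for a
    using LIMSEQ_unique[OF lim suboptimal_iterate_tendsto_0[OF that]] .
  have supp: "set_pmf p = Opt s"
    using p_Opt p_zero m0 by (force simp: set_pmf_iff)
  define \<mu> where "\<mu> = Min (pmf p ` set_pmf p)"
  have \<mu>_le: "\<mu> \<le> pmf p a" if "a \<in> Opt s" for a
    unfolding \<mu>_def supp using that by (intro Min_le) auto
  have \<mu>_pos: "0 < \<mu>"
    unfolding \<mu>_def supp using opt_actions_nonempty[OF valid, of s] p_Opt m0(1)
    by (subst Min_gr_iff) (auto intro: less_le_trans)
  have le_1_\<mu>: "pmf p a \<le> 1 - \<mu>" if a: "a \<in> Opt s" for a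
  proof -
    obtain c where c: "c \<in> Opt s" "c \<noteq> a"
    proof -
      have "\<not> Opt s \<subseteq> {a}"
        using card_mono[of "{a}" "Opt s"] gt1 by auto
      then show ?thesis
        using that by blast
    qed
    then show ?thesis
      using \<mu>_le[OF c(1)] pmf_add_le_1[OF c(2), of p] by linarith
  qed
  obtain a0 where "a0 \<in> Opt s"
    using opt_actions_nonempty[OF valid] by blast
  then have \<mu>: "0 < \<mu> / 2" "\<mu> / 2 \<le> 1 / 2"
    using \<mu>_pos \<mu>_le[of a0] pmf_le_1[of p a0] by auto
  have window: "curvature_window p = {\<mu> / 2..1 - \<mu> / 2}"
    by (simp add: curvature_window_def \<mu>_def)
  have L_eq: "L = (INF x\<in>{\<mu> / 2..1 - \<mu> / 2}. deriv g x)" and U_eq: "U = (SUP x\<in>{\<mu> / 2..1 - \<mu> / 2}. deriv g x)"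
    by (simp_all add: L_def U_def curvature_inf_def curvature_sup_def window)
  show L: "0 < L" and U: "0 < U"
    using curvature_extrema(1,2)[OF \<mu>] unfolding L_eq U_eq by linarith+
  have LU: "L \<le> U"
    using curvature_extrema(2)[OF \<mu>] unfolding L_eq U_eq .
  have "eventually (\<lambda>k. \<forall>a\<in>Opt s. pmf (\<pi> k s) a \<in> {\<mu> / 2..1 - \<mu> / 2}) sequentially"
  proof (rule eventually_ball_finite)
    show "\<forall>a\<in>Opt s. eventually (\<lambda>k. pmf (\<pi> k s) a \<in> {\<mu> / 2..1 - \<mu> / 2}) sequentially"
    proof
      fix a assume a: "a \<in> Opt s"
      have "eventually (\<lambda>k. \<mu> / 2 < pmf (\<pi> k s) a) sequentially"
        using \<mu>_le[OF a] \<mu>_pos by (intro order_tendstoD(1)[OF lim]) linarith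
      moreover have "eventually (\<lambda>k. pmf (\<pi> k s) a < 1 - \<mu> / 2) sequentially"
        using le_1_\<mu>[OF a] \<mu>_pos by (intro order_tendstoD(2)[OF lim]) linarith
      ultimately show "eventually (\<lambda>k. pmf (\<pi> k s) a \<in> {\<mu> / 2..1 - \<mu> / 2}) sequentially"
        by eventually_elim auto
    qed
  qed simp
  then obtain K where range: "\<And>k a. K \<le> k \<Longrightarrow> a \<in> Opt s \<Longrightarrow> pmf (\<pi> k s) a \<in> {\<mu> / 2..1 - \<mu> / 2}"
    unfolding eventually_sequentially by blast
  have "sup_norm (\<lambda>a. pmf (\<pi> k s) a - pmf p a) \<le> U / L * b k s + 2 * \<eta> * U / L\<^sup>2 * tail k" if k: "K \<le> k" for k
  proof -
    have "\<bar>pmf (\<pi> k s) a - pmf p a\<bar> \<le> b k s + \<eta> * tail k / L" for a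
    proof (cases "a \<in> Opt s")
      case True
      \<comment> \<open>Compare iterates \<open>k\<close> and \<open>l\<close>, both in the window, and let \<open>l\<close> tend to infinity.\<close>
      have "\<bar>pmf p a - pmf (\<pi> k s) a\<bar> \<le> \<bar>0 - b k s\<bar> + \<eta> * tail k / L"
      proof (rule LIMSEQ_le)
        show "(\<lambda>l. \<bar>pmf (\<pi> l s) a - pmf (\<pi> k s) a\<bar>) \<longlonglongrightarrow> \<bar>pmf p a - pmf (\<pi> k s) a\<bar>"
          by (intro tendsto_intros lim)
        show "(\<lambda>l. \<bar>b l s - b k s\<bar> + \<eta> * tail k / L) \<longlonglongrightarrow> \<bar>0 - b k s\<bar> + \<eta> * tail k / L"
          by (intro tendsto_intros b_tendsto_0)
        show "\<exists>N. \<forall>l\<ge>N. \<bar>pmf (\<pi> l s) a - pmf (\<pi> k s) a\<bar> \<le> \<bar>b l s - b k s\<bar> + \<eta> * tail k / L"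
          using iterates_close[OF \<mu> range k _ True] unfolding L_eq by blast
      qed
      then show ?thesis
        using b_nonneg[of k s] by linarith
    next
      case False
      moreover have "0 \<le> \<eta> * tail k / L"
        using \<eta>_pos tail_nonneg L by simp
      ultimately show ?thesis
        using iterate_le_b[OF False, of k] p_zero[OF False] by simp
    qed
    then have "sup_norm (\<lambda>a. pmf (\<pi> k s) a - pmf p a) \<le> b k s + \<eta> * tail k / L"
      by (rule sup_norm_le)
    also have "b k s \<le> U / L * b k s"
      using L LU b_nonneg[of k s] by (intro mult_le_cancel_right1[THEN iffD2]) (auto simp: pos_le_divide_eq)
    also have "\<eta> * tail k / L \<le> 2 * \<eta> * U / L\<^sup>2 * tail k"
    proof -
      have "\<eta> * tail k / L * 1 \<le> \<eta> * tail k / L * (2 * U / L)"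
        using L LU \<eta>_pos tail_nonneg[of k] by (intro mult_left_mono) (auto simp: pos_le_divide_eq)
      then show ?thesis
        by (simp add: power2_eq_square mult_ac)
    qed
    finally show ?thesis
      by simp
  qed
  then show "\<exists>K. \<forall>k\<ge>K. sup_norm (\<lambda>a. pmf (\<pi> k s) a - pmf p a) \<le> U / L * b k s + 2 * \<eta> * U / L\<^sup>2 * tail k"
    by blast
qed

lemma limit_and_rates:
  obtains \<pi>_lim where "\<And>s a. (\<lambda>k. pmf (\<pi> k s) a) \<longlonglongrightarrow> pmf (\<pi>_lim s) a"
    "\<And>s k. s \<in> states_eq1 M \<Longrightarrow> sup_norm (\<lambda>a. pmf (\<pi> k s) a - pmf (\<pi>_lim s) a) \<le> b k s"
    "\<And>s. s \<in> states_gt1 M \<Longrightarrow> 0 < curvature_sup (\<pi>_lim s) (deriv g)"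
    "\<And>s. s \<in> states_gt1 M \<Longrightarrow> 0 < curvature_inf (\<pi>_lim s) (deriv g)"
    "\<And>s. s \<in> states_gt1 M \<Longrightarrow> \<exists>K. \<forall>k\<ge>K. sup_norm (\<lambda>a. pmf (\<pi> k s) a - pmf (\<pi>_lim s) a)
        \<le> curvature_sup (\<pi>_lim s) (deriv g) / curvature_inf (\<pi>_lim s) (deriv g) * b k s
          + 2 * \<eta> * curvature_sup (\<pi>_lim s) (deriv g) / (curvature_inf (\<pi>_lim s) (deriv g))\<^sup>2 * tail k"
proof -
  obtain \<pi>_lim where lim: "\<And>s a. (\<lambda>k. pmf (\<pi> k s) a) \<longlonglongrightarrow> pmf (\<pi>_lim s) a"
    using iterates_converge by metis
  have "sup_norm (\<lambda>a. pmf (\<pi> k s) a - pmf (\<pi>_lim s) a) \<le> b k s" if s: "s \<in> states_eq1 M" for s k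
  proof -
    obtain a where a: "Opt s = {a}"
      using s by (auto simp: states_eq1_def card_1_singleton_iff)
    have "pmf (\<pi>_lim s) = pmf (return_pmf a)"
      using LIMSEQ_unique[OF lim unique_optimal_action_limit(1)[OF a]] by blast
    then show ?thesis
      using unique_optimal_action_limit(2)[OF a] by (intro sup_norm_le) simp
  qed
  then show ?thesis
    using that[OF lim] multiple_optimal_actions_rate[OF _ lim] by (simp add: states_gt1_def)
qed

end

theorem theorem3p19:
  shows "\<exists>U L :: 'a::finite pmf \<Rightarrow> (real \<Rightarrow> real) \<Rightarrow> real.
    \<forall>(M :: ('s::finite, 'a) mdp) \<psi> \<eta> \<pi>.
      valid_mdp M \<longrightarrow>
      states_tilde M \<noteq> {} \<longrightarrow>
      mirror_potential \<psi> \<longrightarrow>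
      0 < \<eta> \<longrightarrow>
      pmd_sequence M \<psi> \<eta> \<pi> \<longrightarrow>
      filterlim (ederiv \<psi>) at_bot (at_right 0) \<longrightarrow>
      filterlim (ederiv \<psi>) at_top (at_left 1) \<longrightarrow>
      (\<forall>x\<in>interior (edom \<psi>). ederiv \<psi> differentiable (at x)) \<longrightarrow>
      continuous_on (interior (edom \<psi>)) (deriv (ederiv \<psi>)) \<longrightarrow>
      (\<forall>x\<in>interior (edom \<psi>). 0 < deriv (ederiv \<psi>) x) \<longrightarrow>
      (\<exists>\<pi>_lim :: 's \<Rightarrow> 'a pmf.
        (\<forall>s a. (\<lambda>k. pmf (\<pi> k s) a) \<longlonglongrightarrow> pmf (\<pi>_lim s) a) \<and>
        (\<forall>s\<in>states_eq1 M. \<forall>\<sigma>. 0 < \<sigma> \<and> \<sigma> < gap M / 2 \<longrightarrow>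
          (\<forall>k\<ge>T_iter M \<pi> \<sigma>.
            sup_norm (\<lambda>a. pmf (\<pi> k s) a - pmf (\<pi>_lim s) a) \<le> subopt_prob M (\<pi> k) s \<and>
            subopt_prob M (\<pi> k) s \<le>
              real CARD('a) *
                (phi_inv \<psi> (real k * (\<eta> * (gap M - 2 * \<sigma>) / 2) + C1 M \<psi> \<eta> \<pi> \<sigma> / 2) +
                 chi_inv \<psi> (real k * (\<eta> * (gap M - 2 * \<sigma>) / 2) + C1 M \<psi> \<eta> \<pi> \<sigma> / 2)))) \<and>
        (\<forall>s\<in>states_gt1 M.
          0 < U (\<pi>_lim s) (deriv (ederiv \<psi>)) \<and>
          0 < L (\<pi>_lim s) (deriv (ederiv \<psi>)) \<and>
          summable (\<lambda>t. value_error M (\<pi> t)) \<and>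
          (\<forall>\<sigma>. 0 < \<sigma> \<and> \<sigma> < gap M / 2 \<longrightarrow>
            (\<exists>T3. \<forall>k\<ge>T3.
              sup_norm (\<lambda>a. pmf (\<pi> k s) a - pmf (\<pi>_lim s) a) \<le>
                U (\<pi>_lim s) (deriv (ederiv \<psi>)) / L (\<pi>_lim s) (deriv (ederiv \<psi>)) *
                  subopt_prob M (\<pi> k) s +
                2 * \<eta> * U (\<pi>_lim s) (deriv (ederiv \<psi>)) /
                  (L (\<pi>_lim s) (deriv (ederiv \<psi>)))\<^sup>2 *
                  (\<Sum>t. value_error M (\<pi> (t + k)))))))"
proof (rule exI[of _ curvature_sup], rule exI[of _ curvature_inf], intro allI impI)
  fix M :: "('s, 'a) mdp" and \<psi> \<eta> and \<pi> :: "nat \<Rightarrow> 's \<Rightarrow> 'a pmf"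
  assume "valid_mdp M" "states_tilde M \<noteq> {}" "mirror_potential \<psi>" "0 < \<eta>" "pmd_sequence M \<psi> \<eta> \<pi>"
    "filterlim (ederiv \<psi>) at_bot (at_right 0)" "filterlim (ederiv \<psi>) at_top (at_left 1)"
    "\<forall>x\<in>interior (edom \<psi>). ederiv \<psi> differentiable (at x)"
    "continuous_on (interior (edom \<psi>)) (deriv (ederiv \<psi>))"
    "\<forall>x\<in>interior (edom \<psi>). 0 < deriv (ederiv \<psi>) x"
  then interpret smooth_pmd \<psi> M \<eta> \<pi>
    by unfold_locales
  let ?U = "\<lambda>p. curvature_sup p (deriv (ederiv \<psi>))" and ?L = "\<lambda>p. curvature_inf p (deriv (ederiv \<psi>))"
  let ?y = "\<lambda>k \<sigma>. real k * (\<eta> * (gap M - 2 * \<sigma>) / 2) + C1 M \<psi> \<eta> \<pi> \<sigma> / 2"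
  obtain \<pi>_lim where lim: "\<And>s a. (\<lambda>k. pmf (\<pi> k s) a) \<longlonglongrightarrow> pmf (\<pi>_lim s) a"
    and eq1: "\<And>s k. s \<in> states_eq1 M \<Longrightarrow> sup_norm (\<lambda>a. pmf (\<pi> k s) a - pmf (\<pi>_lim s) a) \<le> b k s"
    and gt1: "\<And>s. s \<in> states_gt1 M \<Longrightarrow> 0 < ?U (\<pi>_lim s)" "\<And>s. s \<in> states_gt1 M \<Longrightarrow> 0 < ?L (\<pi>_lim s)"
      "\<And>s. s \<in> states_gt1 M \<Longrightarrow> \<exists>K. \<forall>k\<ge>K. sup_norm (\<lambda>a. pmf (\<pi> k s) a - pmf (\<pi>_lim s) a)
        \<le> ?U (\<pi>_lim s) / ?L (\<pi>_lim s) * b k s + 2 * \<eta> * ?U (\<pi>_lim s) / (?L (\<pi>_lim s))\<^sup>2 * tail k"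
    by (rule limit_and_rates) blast
  show "\<exists>\<pi>_lim. (\<forall>s a. (\<lambda>k. pmf (\<pi> k s) a) \<longlonglongrightarrow> pmf (\<pi>_lim s) a) \<and>
      (\<forall>s\<in>states_eq1 M. \<forall>\<sigma>. 0 < \<sigma> \<and> \<sigma> < gap M / 2 \<longrightarrow> (\<forall>k\<ge>T_iter M \<pi> \<sigma>.
        sup_norm (\<lambda>a. pmf (\<pi> k s) a - pmf (\<pi>_lim s) a) \<le> b k s \<and>
        b k s \<le> real CARD('a) * (phi_inv \<psi> (?y k \<sigma>) + chi_inv \<psi> (?y k \<sigma>)))) \<and>
      (\<forall>s\<in>states_gt1 M. 0 < ?U (\<pi>_lim s) \<and> 0 < ?L (\<pi>_lim s) \<and> summable err \<and>
        (\<forall>\<sigma>. 0 < \<sigma> \<and> \<sigma> < gap M / 2 \<longrightarrow> (\<exists>T3. \<forall>k\<ge>T3.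
          sup_norm (\<lambda>a. pmf (\<pi> k s) a - pmf (\<pi>_lim s) a)
          \<le> ?U (\<pi>_lim s) / ?L (\<pi>_lim s) * b k s
            + 2 * \<eta> * ?U (\<pi>_lim s) / (?L (\<pi>_lim s))\<^sup>2 * (\<Sum>t. err (t + k)))))"
    using lim eq1 subopt_prob_decay summable_err gt1 unfolding tail_def
    by (intro exI[of _ \<pi>_lim] conjI allI ballI impI) blast+
qed

end
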